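(* Let $d\in(0,1/2)$, $q_0,q_1\in\mathbb{R}$, and let the bivariate series $\{Y_n\}_{n\in\mathbb{Z}}$ be $$Y_n=(I-B)^{-D}Q_+\varepsilon_n+(I-B^{-1})^{-D}Q_-\varepsilon_n,\qquad Q_+=\begin{pmatrix} q_0 & q_1 \\ -q_1 & q_0 \end{pmatrix}=Q_-^T,\quad D=\mathrm{diag}(d,d),$$ where $\{\varepsilon_n\}$ is a bivariate white noise with $\mathbb{E}\varepsilon_n\varepsilon_n^T=I_2$. Then the autocovariance function $\gamma_Y(h)=\mathbb{E}Y_{n+h}Y_n^T$ satisfies $\gamma_{Y,11}=\gamma_{Y,22}$ and $\gamma_{Y,12}=-\gamma_{Y,21}$ on $\mathbb{Z}$, with, for $h\in\mathbb{Z}$, $$\begin{aligned} \gamma_{Y,11}(h)=\gamma_{Y,22}(h)={}&q_0^2\left(2\frac{\Gamma(1-2d)\Gamma(h+d)\sin(\pi d)}{\Gamma(h+1-d)\pi}+\frac{\Gamma(2d+h)}{\Gamma(2d)\Gamma(1+h)}\mathbf{1}_{\{h\ge0\}}+\frac{\Gamma(2d-h)}{\Gamma(2d)\Gamma(1-h)}\mathbf{1}_{\{h\le0\}}\right) \\ &+q_1^2\left(2\frac{\Gamma(1-2d)\Gamma(h+d)\sin(\pi d)}{\Gamma(h+1-d)\pi}-\frac{\Gamma(2d+h)}{\Gamma(2d)\Gamma(1+h)}\mathbf{1}_{\{h\ge0\}}-\frac{\Gamma(2d-h)}{\Gamma(2d)\Gamma(1-h)}\mathbf{1}_{\{h\le0\}}\right),\end{aligned}$$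 $$\gamma_{Y,12}(h)=-\gamma_{Y,21}(h)=\operatorname{sign}(h)\frac{2q_0q_1}{\Gamma(2d)}\frac{\Gamma(|h|+2d)}{\Gamma(1+|h|)},$$ and, as $h\to\infty$, $$\gamma_Y(h)\sim\begin{pmatrix} r_0 & -r_1 \\ r_1 & r_0 \end{pmatrix}h^{2d-1}$$ with $$r_0=\frac{1}{\Gamma(2d)}\left[q_0^2\left(\frac{1}{\cos(\pi d)}+1\right)+q_1^2\left(\frac{1}{\cos(\pi d)}-1\right)\right],\qquad r_1=-\frac{2q_0q_1}{\Gamma(2d)}.$$
   Context: $B$ is the backward shift, $B^kZ_n=Z_{n-k}$ for $k\in\mathbb{Z}$. The operators are $(I-B^{\pm1})^{-D}=\mathrm{diag}\big((I-B^{\pm1})^{-d},(I-B^{\pm1})^{-d}\big)$ with $(I-B^{\pm1})^{-d}=\sum_{k=0}^\infty c_{d,k}B^{\pm k}$, $c_{d,k}=\frac{\Gamma(k+d)}{\Gamma(k+1)\Gamma(d)}$ (Taylor coefficients of $(1-x)^{-d}$); thus $Y_n=\sum_{k\ge0}c_{d,k}Q_+\varepsilon_{n-k}+\sum_{k\ge0}c_{d,k}Q_-\varepsilon_{n+k}$, converging in mean square. White noise means $\mathbb{E}\varepsilon_n=0$, $\mathbb{E}\varepsilon_n\varepsilon_m^T=0$ for $n\ne m$, $\mathbb{E}\varepsilon_n\varepsilon_n^T=I_2$. $\operatorname{sign}(h)=1,0,-1$ for $h>0$, $h=0$, $h<0$. A term multiplied by an indicator that vanishes is taken to be $0$. The matrix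 relation $\sim$ is entrywise: $\gamma_{Y,jk}(h)=R_{jk}h^{2d-1}+o(h^{2d-1})$, where $R_{jk}$ denotes the $(j,k)$ entry of the coefficient matrix on the right-hand side. *)

theory Defs
  imports "HOL-Probability.Probability"
begin

definition sq_integrable :: "'w measure \<Rightarrow> ('w \<Rightarrow> 'b::euclidean_space) \<Rightarrow> bool" where
  "sq_integrable M X \<longleftrightarrow> X \<in> borel_measurable M \<and> integrable M (\<lambda>\<omega>. (norm (X \<omega>))\<^sup>2)"

definition ms_sums :: "'w measure \<Rightarrow> (nat \<Rightarrow> 'w \<Rightarrow> real) \<Rightarrow> ('w \<Rightarrow> real) \<Rightarrow> bool" where
  "ms_sums M X S \<longleftrightarrow>
     (\<forall>k. sq_integrable M (X k)) \<and> sq_integrable M S \<and>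
     (\<lambda>N. \<integral>\<omega>. ((\<Sum>k<N. X k \<omega>) - S \<omega>)\<^sup>2 \<partial>M) \<longlonglongrightarrow> 0"

(* The sum of a series converging in mean square is determined up to almost sure
   equality only; ms_suminf selects one version. *)
definition ms_suminf :: "'w measure \<Rightarrow> (nat \<Rightarrow> 'w \<Rightarrow> real) \<Rightarrow> 'w \<Rightarrow> real" where
  "ms_suminf M X = (SOME S. ms_sums M X S)"

definition backshift_pow :: "int \<Rightarrow> (int \<Rightarrow> 'b) \<Rightarrow> int \<Rightarrow> 'b" where
  "backshift_pow k Z = (\<lambda>n. Z (n - k))"

definition frac_coeff :: "real \<Rightarrow> nat \<Rightarrow> real" where
  "frac_coeff d k = Gamma (real k + d) / (Gamma (real k + 1) * Gamma d)"

(* frac_int M d s is the operator (I - B^s)^(-d), used with s = 1 and s = -1. *)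
definition frac_int ::
    "'w measure \<Rightarrow> real \<Rightarrow> int \<Rightarrow> (int \<Rightarrow> 'w \<Rightarrow> real) \<Rightarrow> int \<Rightarrow> 'w \<Rightarrow> real" where
  "frac_int M d s Z n =
     ms_suminf M (\<lambda>k \<omega>. frac_coeff d k * backshift_pow (s * int k) Z n \<omega>)"

(* (I - B^s)^(-D) for D = diag(d,d): the scalar operator acting on each component. *)
definition frac_int2 ::
    "'w measure \<Rightarrow> real \<Rightarrow> int \<Rightarrow> (int \<Rightarrow> 'w \<Rightarrow> real^2) \<Rightarrow> int \<Rightarrow> 'w \<Rightarrow> real^2" where
  "frac_int2 M d s Z n = (\<lambda>\<omega>. \<chi> j. frac_int M d s (\<lambda>m \<omega>'. Z m \<omega>' $ j) n \<omega>)"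

definition vvT :: "real^2 \<Rightarrow> real^2 \<Rightarrow> real^2^2" where
  "vvT v w = (columnvector v :: real^1^2) ** rowvector w"

definition white_noise :: "'w measure \<Rightarrow> (int \<Rightarrow> 'w \<Rightarrow> real^2) \<Rightarrow> bool" where
  "white_noise M \<epsilon> \<longleftrightarrow>
     (\<forall>n. sq_integrable M (\<epsilon> n)) \<and>
     (\<forall>n. (\<integral>\<omega>. \<epsilon> n \<omega> \<partial>M) = 0) \<and>
     (\<forall>n m. n \<noteq> m \<longrightarrow> (\<integral>\<omega>. vvT (\<epsilon> n \<omega>) (\<epsilon> m \<omega>) \<partial>M) = 0) \<and>
     (\<forall>n. (\<integral>\<omega>. vvT (\<epsilon> n \<omega>) (\<epsilon> n \<omega>) \<partial>M) = mat 1)"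

(* The base time n is kept as an argument, so that independence of n
   (stationarity) is not built into the definition. *)
definition autocov :: "'w measure \<Rightarrow> (int \<Rightarrow> 'w \<Rightarrow> real^2) \<Rightarrow> int \<Rightarrow> int \<Rightarrow> real^2^2" where
  "autocov M Y n h = (\<integral>\<omega>. vvT (Y (n + h) \<omega>) (Y n \<omega>) \<partial>M)"

end

theory Submission
  imports Defs
begin

text \<open>
  Both one-sided series converge in mean square because the coefficients
  \<open>c k = frac_coeff d k\<close> are square summable and the noise is orthogonal, so the autocovariance is the
  limit of that of the partial sums. There the two products of equally directed series contribute
  \<open>\<Sum>l. c (l + h) * c l\<close>, a Beta integral, with the matrices \<open>Q\<^sub>+ Q\<^sub>+\<^sup>T\<close> and \<open>Q\<^sub>- Q\<^sub>-\<^sup>T\<close>; the two mixed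
  products contribute the convolutions \<open>\<Sum>k\<le>m. c k * c (m - k)\<close> for \<open>m = h\<close> and \<open>m = - h\<close>, which are
  Vandermonde sums, with the matrices \<open>Q\<^sub>+ Q\<^sub>-\<^sup>T\<close> and \<open>Q\<^sub>- Q\<^sub>+\<^sup>T\<close>. The asymptotics follow from those of
  ratios of Gamma functions.
\<close>

section \<open>Fractional coefficients: binomial form, power series and convolution\<close>

lemma frac_coeff_pochhammer:
  assumes "0 < d"
  shows "frac_coeff d k = pochhammer d k / fact k"
proof -
  have "d \<notin> \<int>\<^sub>\<le>\<^sub>0" using assms by auto
  then show ?thesis
    using Gamma_fact[of k, where 'a = real]
    by (simp add: frac_coeff_def pochhammer_Gamma add.commute)
qed

lemma frac_coeff_nonneg: "0 < d \<Longrightarrow> 0 \<le> frac_coeff d k"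
  by (simp add: frac_coeff_pochhammer pochhammer_nonneg)

text \<open>Bridge to generalised binomial coefficients with upper entry \<open>- d\<close>, through
  which the binomial series and Vandermonde's identity become available.\<close>

lemma frac_coeff_gbinomial:
  assumes "0 < d"
  shows "frac_coeff d k = (- 1) ^ k * ((- d) gchoose k)"
  by (simp add: frac_coeff_pochhammer[OF assms] gbinomial_pochhammer flip: power_mult_distrib)

lemma frac_coeff_power_sums:
  assumes "0 < d" "\<bar>t\<bar> < 1"
  shows "(\<lambda>k. frac_coeff d k * t ^ k) sums (1 - t) powr (- d)"
proof -
  have "frac_coeff d k * t ^ k = ((- d) gchoose k) * (- t) ^ k" for k
    by (simp add: frac_coeff_gbinomial[OF assms(1)] power_minus[of t])
  then show ?thesis
    using gen_binomial_real[of "- t" "- d"] assms(2) by simp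
qed

text \<open>Compares coefficients in \<open>(1 - x) powr (- d) * (1 - x) powr (- e) = (1 - x) powr
  (- (d + e))\<close>. The signs of the two factors combine to \<open>(- 1) ^ n\<close>, which
  leaves the Vandermonde identity for \<open>- d\<close> and \<open>- e\<close>.\<close>

lemma frac_coeff_Vandermonde:
  assumes "0 < d" "0 < e"
  shows "(\<Sum>k\<le>n. frac_coeff d k * frac_coeff e (n - k)) = frac_coeff (d + e) n"
proof -
  have "(\<Sum>k\<le>n. frac_coeff d k * frac_coeff e (n - k))
      = (\<Sum>k\<le>n. (- 1) ^ n * (((- d) gchoose k) * ((- e) gchoose (n - k))))"
  proof (rule sum.cong)
    fix k assume "k \<in> {..n}"
    then have "(- 1 :: real) ^ n = (- 1) ^ k * (- 1) ^ (n - k)"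
      by (simp flip: power_add)
    then show "frac_coeff d k * frac_coeff e (n - k)
        = (- 1) ^ n * (((- d) gchoose k) * ((- e) gchoose (n - k)))"
      using assms by (simp add: frac_coeff_gbinomial)
  qed simp
  also have "\<dots> = (- 1) ^ n * ((- d + - e) gchoose n)"
    using gbinomial_Vandermonde[of "- d" "- e" n]
    by (simp add: atMost_atLeast0 flip: sum_distrib_left)
  also have "\<dots> = frac_coeff (d + e) n"
    using assms by (simp add: frac_coeff_gbinomial)
  finally show ?thesis .
qed

section \<open>Autocorrelation of the coefficients and its limits along double sums\<close>

text \<open>Inherited from the complex formula. At an integer \<open>x\<close> one of the two Gamma
  arguments is a pole and the sine vanishes, so both sides are 0 by convention.\<close>

lemma Gamma_reflection_real:
  fixes x :: real
  shows "Gamma x * Gamma (1 - x) = pi / sin (pi * x)"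
proof -
  have "complex_of_real (Gamma x * Gamma (1 - x)) = complex_of_real (pi / sin (pi * x))"
    using Gamma_reflection_complex[of "of_real x"] Gamma_complex_of_real[of "1 - x"]
    by (simp add: Gamma_complex_of_real flip: sin_of_real)
  then show ?thesis using of_real_eq_iff by blast
qed

text \<open>The lag-\<open>h\<close> autocovariance of one-sided fractional noise with unit
  innovations. The lag is a real argument so that natural and integer lags can both be
  inserted.\<close>

definition frac_autocorr :: "real \<Rightarrow> real \<Rightarrow> real" where
  "frac_autocorr d h =
     Gamma (1 - 2 * d) * Gamma (h + d) * sin (pi * d) / (Gamma (h + 1 - d) * pi)"

text \<open>Reflection at \<open>h + d\<close> and at \<open>- h + d\<close> yields two Gamma
  products whose sine arguments differ by \<open>2 * pi * h\<close>, so the products agree. Both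
  \<open>d\<close> and \<open>1 - d\<close> lie strictly between 0 and 1, so no argument is a pole
  and the products may be rearranged into quotients.\<close>

lemma frac_autocorr_uminus:
  assumes "0 < d" "d < 1 / 2"
  shows "frac_autocorr d (of_int (- h)) = frac_autocorr d (of_int h)"
proof -
  have non: "of_int k + x \<notin> \<int>" if "0 < x" "x < 1" for k :: int and x :: real
  proof
    assume "of_int k + x \<in> \<int>"
    then have "of_int k + x - of_int k \<in> \<int>" by (intro Ints_diff) auto
    then obtain m where "x = of_int m" by (auto elim: Ints_cases)
    with that show False by simp
  qed
  have G0: "Gamma (of_int k + x) \<noteq> 0" if "0 < x" "x < 1" for k :: int and x :: real
    using non[OF that, of k] nonpos_Ints_Int by (auto simp: Gamma_eq_zero_iff)
  have r1: "Gamma (of_int h + d) * Gamma (of_int (- h) + (1 - d)) = pi / sin (pi * (of_int h + d))"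
    using Gamma_reflection_real[of "of_int h + d"] by (simp add: algebra_simps)
  have r2: "Gamma (of_int (- h) + d) * Gamma (of_int h + (1 - d)) = pi / sin (pi * (of_int (- h) + d))"
    using Gamma_reflection_real[of "of_int (- h) + d"] by (simp add: algebra_simps)
  have "sin (pi * (of_int h + d)) = sin (pi * (of_int (- h) + d) + (2 * pi) * of_int h)"
    by (rule arg_cong[where f = sin]) (simp add: algebra_simps)
  also have "\<dots> = sin (pi * (of_int (- h) + d))"
    by (subst sin_add) (simp only: sin_int_2pin cos_int_2pin mult_1_right mult_zero_right add_0_right)
  finally have sin_eq: "sin (pi * (of_int h + d)) = sin (pi * (of_int (- h) + d))" .
  have prod_eq: "Gamma (of_int h + d) * Gamma (of_int (- h) + (1 - d))
      = Gamma (of_int (- h) + d) * Gamma (of_int h + (1 - d))"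
    by (rule trans[OF r1[unfolded sin_eq] r2[symmetric]])
  have "0 < 1 - d" "1 - d < 1" using assms by auto
  note nz = G0[OF this]
  have "Gamma (of_int h + d) / Gamma (of_int h + (1 - d))
      = Gamma (of_int (- h) + d) / Gamma (of_int (- h) + (1 - d))"
    by (rule iffD2[OF frac_eq_eq[OF nz nz] prod_eq])
  moreover have eq: "frac_autocorr d (of_int k)
      = Gamma (1 - 2 * d) * sin (pi * d) / pi * (Gamma (of_int k + d) / Gamma (of_int k + (1 - d)))"
    for k :: int
    unfolding frac_autocorr_def by (simp add: add_diff_eq mult_ac)
  ultimately show ?thesis unfolding eq by (simp only:)
qed

text \<open>With \<open>c l = frac_coeff d l\<close>, write one factor as a Beta integral,
  \<open>c (l + h) = Beta (l + h + d) (1 - d) / (Gamma d * Gamma (1 - d))\<close>, and sum the other one under the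
  integral: as \<open>\<Sum>l. c l * t ^ l\<close> is \<open>(1 - t) powr (- d)\<close>, this leaves \<open>Beta (h + d) (1 - 2 * d)\<close>.\<close>
lemma frac_coeff_autocorr_sums:
  assumes d: "0 < d" "d < 1 / 2"
  shows "(\<lambda>l. frac_coeff d (l + h) * frac_coeff d l) sums frac_autocorr d (real h)"
proof -
  define C where "C = Gamma d * Gamma (1 - d)"
  have "sin (pi * d) > 0" using d by (intro sin_gt_zero) auto
  then have C: "C = pi / sin (pi * d)" "C > 0"
    unfolding C_def using Gamma_reflection_real[of d] by auto
  \<comment> \<open>\<open>g\<close> is the Beta integrand with parameters \<open>h + d\<close> and
    \<open>1 - 2 * d\<close>; \<open>u l\<close> is \<open>frac_coeff d l\<close> times the one with
    parameters \<open>l + h + d\<close> and \<open>1 - d\<close>.\<close>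
  define g where "g = (\<lambda>t::real. t powr (real h + d - 1) * (1 - t) powr (1 - 2 * d - 1))"
  define u where "u = (\<lambda>l (t::real). frac_coeff d l * (t powr (real (l + h) + d - 1) * (1 - t) powr (1 - d - 1)))"
  have Bc: "Beta (real (l + h) + d) (1 - d) = C * frac_coeff d (l + h)" for l
  proof -
    have "Gamma d > 0" using d by (intro Gamma_real_pos)
    moreover have "real (l + h) + d + (1 - d) = real (l + h) + 1" by simp
    then have "Beta (real (l + h) + d) (1 - d)
        = Gamma (real (l + h) + d) * Gamma (1 - d) / Gamma (real (l + h) + 1)"
      unfolding Beta_def by (rule arg_cong)
    ultimately show ?thesis
      unfolding C_def frac_coeff_def by simp
  qed
  \<comment> \<open>Dropping the endpoints gives \<open>0 < t < 1\<close>, as the binomial series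
    and the rewriting of \<open>t ^ l\<close> by \<open>powr\<close> require.\<close>
  have u: "(u l has_integral frac_coeff d l * (C * frac_coeff d (l + h))) {0<..<1}" for l
    unfolding u_def Bc[symmetric] has_integral_Icc_iff_Ioo[symmetric]
    by (intro has_integral_mult_right has_integral_Beta_real) (use d in auto)
  \<comment> \<open>The bound \<open>d < 1 / 2\<close> makes the second parameter positive, hence
    \<open>g\<close> integrable near 1.\<close>
  have g: "(g has_integral Beta (real h + d) (1 - 2 * d)) {0<..<1}"
    unfolding g_def has_integral_Icc_iff_Ioo[symmetric]
    by (intro has_integral_Beta_real) (use d in auto)
  have ug: "(\<lambda>l. u l t) sums g t" if "t \<in> {0<..<1}" for t
  proof -
    have "(\<lambda>l. t powr (real h + d - 1) * (1 - t) powr (- d) * (frac_coeff d l * t ^ l))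
        sums (t powr (real h + d - 1) * (1 - t) powr (- d) * (1 - t) powr (- d))"
      by (intro sums_mult frac_coeff_power_sums) (use d that in auto)
    moreover have "t powr (real h + d - 1) * (1 - t) powr (- d) * (frac_coeff d l * t ^ l) = u l t" for l
      using that by (simp add: u_def powr_realpow[symmetric] powr_add powr_diff)
    moreover have "t powr (real h + d - 1) * (1 - t) powr (- d) * (1 - t) powr (- d) = g t"
      by (simp add: g_def mult.assoc flip: powr_add)
    ultimately show ?thesis by simp
  qed
  have u0: "0 \<le> u l t" for l t
    by (simp add: u_def frac_coeff_nonneg d)
  have su: "((\<lambda>t. \<Sum>l<N. u l t) has_integral (\<Sum>l<N. frac_coeff d l * (C * frac_coeff d (l + h)))) {0<..<1}" for N
    by (intro has_integral_sum u) auto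
  have "(\<lambda>N. integral {0<..<1} (\<lambda>t. \<Sum>l<N. u l t)) \<longlonglongrightarrow> integral {0<..<1} g"
  \<comment> \<open>The terms are nonnegative, so every partial sum is dominated by the full sum
    \<open>g\<close> itself.\<close>
  proof (rule dominated_convergence(2)[where h = g])
    show "(\<lambda>t. \<Sum>l<N. u l t) integrable_on {0<..<1}" for N
      using su[of N] by blast
    show "g integrable_on {0<..<1}" using g by blast
    show "norm (\<Sum>l<N. u l t) \<le> g t" if "t \<in> {0<..<1}" for N t
    proof -
      have "(\<Sum>l<N. u l t) \<le> g t"
        unfolding sums_unique[OF ug[OF that]]
        by (rule sum_le_suminf[OF sums_summable[OF ug[OF that]]]) (auto simp: u0)
      then show ?thesis by (simp add: sum_nonneg u0)
    qed
    show "(\<lambda>N. \<Sum>l<N. u l t) \<longlonglongrightarrow> g t" if "t \<in> {0<..<1}" for t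
      using ug[OF that] by (simp add: sums_def)
  qed
  then have "(\<lambda>l. frac_coeff d l * (C * frac_coeff d (l + h))) sums Beta (real h + d) (1 - 2 * d)"
    unfolding sums_def integral_unique[OF su] integral_unique[OF g] .
  from sums_mult[OF this, of "1 / C"]
  have "(\<lambda>l. frac_coeff d (l + h) * frac_coeff d l) sums (Beta (real h + d) (1 - 2 * d) / C)"
    using C(2) by (simp add: mult_ac)
  moreover have "Beta (real h + d) (1 - 2 * d) / C = frac_autocorr d (real h)"
  proof -
    have "real h + d + (1 - 2 * d) = real h + 1 - d" by simp
    then show ?thesis
      unfolding Beta_def frac_autocorr_def C(1) by (simp only:) (simp add: mult_ac)
  qed
  ultimately show ?thesis by simp
qed

lemma frac_coeff_sq_summable:
  assumes "0 < d" "d < 1 / 2"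
  shows "summable (\<lambda>k. (frac_coeff d k)\<^sup>2)"
  using frac_coeff_autocorr_sums[OF assms, of 0] by (auto simp: power2_eq_square sums_iff)

text \<open>This double sum is what the covariance of two equally directed partial sums leaves. For
  \<open>h \<ge> 0\<close> the diagonal inside the square is a partial sum of the autocorrelation
  series; exchanging \<open>k\<close> and \<open>l\<close> reduces negative \<open>h\<close> to this
  case by evenness of the limit.\<close>

lemma frac_coeff_difference_sums:
  assumes d: "0 < d" "d < 1 / 2"
  shows "(\<lambda>N. \<Sum>k<N. \<Sum>l<N. if int k - int l = h then frac_coeff d k * frac_coeff d l else 0)
           \<longlonglongrightarrow> frac_autocorr d (of_int h)"
proof -
  have nonneg: "(\<lambda>N. \<Sum>k<N. \<Sum>l<N. if int k - int l = int m then frac_coeff d k * frac_coeff d l else 0)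
           \<longlonglongrightarrow> frac_autocorr d (of_int (int m))" for m
  proof -
    \<comment> \<open>On the diagonal \<open>k = l + m\<close>, the bound \<open>k < N\<close> says
      \<open>l < N - m\<close>; truncated subtraction leaves an empty range when
      \<open>N \<le> m\<close>.\<close>
    have eq: "(\<Sum>k<N. \<Sum>l<N. if int k - int l = int m then frac_coeff d k * frac_coeff d l else 0)
        = (\<Sum>l<N - m. frac_coeff d (l + m) * frac_coeff d l)" for N
    proof -
      have "(\<Sum>k<N. \<Sum>l<N. if int k - int l = int m then frac_coeff d k * frac_coeff d l else 0)
          = (\<Sum>l<N. \<Sum>k<N. if k = l + m then frac_coeff d k * frac_coeff d l else 0)"
        by (subst sum.swap) (intro sum.cong refl if_cong, auto)
      also have "\<dots> = (\<Sum>l<N. if l < N - m then frac_coeff d (l + m) * frac_coeff d l else 0)"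
        by (intro sum.cong) (auto simp: sum.delta less_diff_conv)
      also have "\<dots> = (\<Sum>l<N - m. frac_coeff d (l + m) * frac_coeff d l)"
        by (rule sum.mono_neutral_cong_right) auto
      finally show ?thesis .
    qed
    have "filterlim (\<lambda>N. N - m) sequentially sequentially"
      by (rule filterlim_minus_const_nat_at_top)
    then have "(\<lambda>N. \<Sum>l<N - m. frac_coeff d (l + m) * frac_coeff d l) \<longlonglongrightarrow> frac_autocorr d (real m)"
      by (rule filterlim_compose[rotated]) (use frac_coeff_autocorr_sums[OF d, of m] in \<open>simp add: sums_def\<close>)
    then show ?thesis unfolding eq by simp
  qed
  show ?thesis
  proof (cases "0 \<le> h")
    case True
    then show ?thesis using nonneg[of "nat h"] by simp
  next
    case False
    have "(\<Sum>k<N. \<Sum>l<N. if int k - int l = h then frac_coeff d k * frac_coeff d l else 0)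
        = (\<Sum>k<N. \<Sum>l<N. if int k - int l = int (nat (- h)) then frac_coeff d k * frac_coeff d l else 0)" for N
      by (subst sum.swap) (use False in \<open>intro sum.cong refl if_cong, auto simp: mult.commute\<close>)
    then show ?thesis
      using nonneg[of "nat (- h)"] False frac_autocorr_uminus[OF d, of h] by simp
  qed
qed

text \<open>For \<open>h \<ge> 0\<close> the antidiagonal \<open>k + l = h\<close> lies inside the
  square as soon as \<open>N > h\<close>, so the sequence is eventually constant. For negative
  \<open>h\<close> the antidiagonal is empty.\<close>

lemma frac_coeff_convolution_sums:
  assumes d: "0 < d"
  shows "(\<lambda>N. \<Sum>k<N. \<Sum>l<N. if int k + int l = h then frac_coeff d k * frac_coeff d l else 0)
           \<longlonglongrightarrow> (if 0 \<le> h then frac_coeff (2 * d) (nat h) else 0)"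
proof (cases "0 \<le> h")
  case True
  define m where "m = nat h"
  have h: "h = int m" using True by (simp add: m_def)
  have "(\<Sum>k<N. \<Sum>l<N. if int k + int l = h then frac_coeff d k * frac_coeff d l else 0)
      = frac_coeff (2 * d) m" if "m < N" for N
  proof -
    have "(\<Sum>k<N. \<Sum>l<N. if int k + int l = h then frac_coeff d k * frac_coeff d l else 0)
        = (\<Sum>k<N. if k \<le> m then frac_coeff d k * frac_coeff d (m - k) else 0)"
    proof (rule sum.cong[OF refl])
      fix k assume "k \<in> {..<N}"
      show "(\<Sum>l<N. if int k + int l = h then frac_coeff d k * frac_coeff d l else 0)
          = (if k \<le> m then frac_coeff d k * frac_coeff d (m - k) else 0)"
      proof (cases "k \<le> m")
        case True
        then have "(int k + int l = h) = (l = m - k)" for l using h by auto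
        then show ?thesis using True that by (simp add: sum.delta)
      qed (simp add: h)
    qed
    also have "\<dots> = (\<Sum>k\<le>m. frac_coeff d k * frac_coeff d (m - k))"
      using that by (intro sum.mono_neutral_cong_right) auto
    also have "\<dots> = frac_coeff (2 * d) m"
      using frac_coeff_Vandermonde[OF d d, of m] by simp
    finally show ?thesis .
  qed
  then show ?thesis
    using True by (intro tendsto_eventually eventually_sequentiallyI[of "Suc m"]) (auto simp: m_def)
next
  case False
  then have "(\<Sum>k<N. \<Sum>l<N. if int k + int l = h then frac_coeff d k * frac_coeff d l else 0) = 0" for N
    by (intro sum.neutral ballI) auto
  then show ?thesis using False by simp
qed

section \<open>Asymptotics of Gamma quotients\<close>

text \<open>Euler's product limit for \<open>Gamma z\<close>, with the Pochhammer symbol written as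
  a Gamma quotient. The factor \<open>fact (n - 1)\<close> does not depend on \<open>z\<close> and
  therefore cancels between two shifts.\<close>

lemma Gamma_shift_asymp:
  fixes z :: real
  assumes "0 < z"
  shows "(\<lambda>n. Gamma (real n + z) / (fact (n - 1) * real n powr z)) \<longlonglongrightarrow> 1"
proof -
  have z: "Gamma z > 0" using assms by (intro Gamma_real_pos)
  have "(\<lambda>n. Gamma z / Gamma_series' z n) \<longlonglongrightarrow> Gamma z / Gamma z"
    using z by (intro tendsto_intros Gamma_series'_LIMSEQ) auto
  then have lim: "(\<lambda>n. Gamma z / Gamma_series' z n) \<longlonglongrightarrow> 1" using z by simp
  have "Gamma z / Gamma_series' z n = Gamma (real n + z) / (fact (n - 1) * real n powr z)"
    if "0 < n" for n
  proof -
    have "z \<notin> \<int>\<^sub>\<le>\<^sub>0" using assms by auto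
    then show ?thesis
      using that z by (simp add: Gamma_series'_def pochhammer_Gamma powr_def add.commute)
  qed
  then have "eventually (\<lambda>n. Gamma z / Gamma_series' z n
      = Gamma (real n + z) / (fact (n - 1) * real n powr z)) sequentially"
    by (intro eventually_sequentiallyI[of 1]) auto
  from Lim_transform_eventually[OF lim this] show ?thesis .
qed

lemma Gamma_ratio_asymp:
  fixes a b :: real
  assumes "0 < a" "0 < b"
  shows "((\<lambda>h::int. Gamma (of_int h + a) / Gamma (of_int h + b) / of_int h powr (a - b))
           \<longlongrightarrow> 1) at_top"
proof -
  have "(\<lambda>n. (Gamma (real n + a) / (fact (n - 1) * real n powr a))
      / (Gamma (real n + b) / (fact (n - 1) * real n powr b))) \<longlonglongrightarrow> 1 / 1"
    by (intro tendsto_divide Gamma_shift_asymp assms) simp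
  moreover have "(Gamma (real n + a) / (fact (n - 1) * real n powr a))
      / (Gamma (real n + b) / (fact (n - 1) * real n powr b))
      = Gamma (real n + a) / Gamma (real n + b) / real n powr (a - b)" for n
    by (simp add: powr_diff)
  ultimately have "(\<lambda>n. Gamma (real n + a) / Gamma (real n + b) / real n powr (a - b)) \<longlonglongrightarrow> 1"
    by simp
  then have "((\<lambda>h. Gamma (real (nat h) + a) / Gamma (real (nat h) + b) / real (nat h) powr (a - b))
      \<longlongrightarrow> 1) at_top"
    by (rule filterlim_compose) (rule filterlim_nat_sequentially)
  moreover have "eventually (\<lambda>h. Gamma (real (nat h) + a) / Gamma (real (nat h) + b) / real (nat h) powr (a - b)
      = Gamma (of_int h + a) / Gamma (of_int h + b) / of_int h powr (a - b)) at_top"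
    using eventually_ge_at_top[of "0::int"] by eventually_elim simp
  ultimately show ?thesis by (rule Lim_transform_eventually)
qed

section \<open>Square integrable functions and mean-square limits\<close>

lemma sq_integrable_real: "sq_integrable M (X :: _ \<Rightarrow> real) \<longleftrightarrow> X \<in> borel_measurable M \<and> integrable M (\<lambda>\<omega>. (X \<omega>)\<^sup>2)"
  by (simp add: sq_integrable_def)

lemma sq_integrable_mult:
  fixes X Y :: "'w \<Rightarrow> real"
  assumes "sq_integrable M X" "sq_integrable M Y"
  shows "integrable M (\<lambda>\<omega>. X \<omega> * Y \<omega>)"
proof (rule Bochner_Integration.integrable_bound)
  show "integrable M (\<lambda>\<omega>. (X \<omega>)\<^sup>2 + (Y \<omega>)\<^sup>2)"
    using assms by (simp add: sq_integrable_real)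
  show "(\<lambda>\<omega>. X \<omega> * Y \<omega>) \<in> borel_measurable M"
    using assms by (auto simp: sq_integrable_real)
  have "\<bar>x * y\<bar> \<le> x\<^sup>2 + y\<^sup>2" for x y :: real
  proof -
    have "2 * (\<bar>x\<bar> * \<bar>y\<bar>) \<le> x\<^sup>2 + y\<^sup>2"
      using sum_squares_bound[of "\<bar>x\<bar>" "\<bar>y\<bar>"] by (simp add: mult.assoc)
    moreover have "0 \<le> \<bar>x\<bar> * \<bar>y\<bar>" by simp
    ultimately show ?thesis unfolding abs_mult by linarith
  qed
  then show "AE \<omega> in M. norm (X \<omega> * Y \<omega>) \<le> norm ((X \<omega>)\<^sup>2 + (Y \<omega>)\<^sup>2)"
    by (simp add: abs_of_nonneg)
qed

lemma sq_integrable_cmult: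
  fixes X :: "'w \<Rightarrow> real"
  shows "sq_integrable M X \<Longrightarrow> sq_integrable M (\<lambda>\<omega>. c * X \<omega>)"
  by (auto simp: sq_integrable_real power_mult_distrib)

lemma sq_integrable_add:
  fixes X Y :: "'w \<Rightarrow> real"
  assumes "sq_integrable M X" "sq_integrable M Y"
  shows "sq_integrable M (\<lambda>\<omega>. X \<omega> + Y \<omega>)"
proof -
  have "integrable M (\<lambda>\<omega>. (X \<omega>)\<^sup>2 + (Y \<omega>)\<^sup>2 + 2 * (X \<omega> * Y \<omega>))"
    by (intro Bochner_Integration.integrable_add integrable_mult_right sq_integrable_mult[OF assms])
      (use assms in \<open>simp_all add: sq_integrable_real\<close>)
  then show ?thesis
    using assms by (auto simp: sq_integrable_real power2_sum mult.assoc)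
qed

lemma sq_integrable_diff:
  fixes X Y :: "'w \<Rightarrow> real"
  assumes "sq_integrable M X" "sq_integrable M Y"
  shows "sq_integrable M (\<lambda>\<omega>. X \<omega> - Y \<omega>)"
proof -
  have "X \<omega> + - 1 * Y \<omega> = X \<omega> - Y \<omega>" for \<omega> by simp
  then show ?thesis
    using sq_integrable_add[OF assms(1) sq_integrable_cmult[OF assms(2), of "- 1"]] by (simp only:)
qed

lemma sq_integrable_sum:
  fixes X :: "'i \<Rightarrow> 'w \<Rightarrow> real"
  assumes "\<And>i. i \<in> I \<Longrightarrow> sq_integrable M (X i)"
  shows "sq_integrable M (\<lambda>\<omega>. \<Sum>i\<in>I. X i \<omega>)"
  using assms
proof (induction I rule: infinite_finite_induct)
  case (insert i I)
  then show ?case by (simp add: sq_integrable_add)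
qed (auto simp: sq_integrable_real)

text \<open>The integral of \<open>(s * X - t * Y)^2\<close> is a nonnegative quadratic form in
  \<open>s\<close> and \<open>t\<close>; at \<open>s = b\<close>, \<open>t = a\<close> its value is
  \<open>a * (a * c - b^2)\<close>, so no division by \<open>a\<close> occurs.\<close>

lemma Cauchy_Schwarz_integral:
  fixes X Y :: "'w \<Rightarrow> real"
  assumes X: "sq_integrable M X" and Y: "sq_integrable M Y"
  shows "(\<integral>\<omega>. X \<omega> * Y \<omega> \<partial>M)\<^sup>2 \<le> (\<integral>\<omega>. (X \<omega>)\<^sup>2 \<partial>M) * (\<integral>\<omega>. (Y \<omega>)\<^sup>2 \<partial>M)"
proof -
  define a b c where "a = (\<integral>\<omega>. (X \<omega>)\<^sup>2 \<partial>M)" and "b = (\<integral>\<omega>. X \<omega> * Y \<omega> \<partial>M)"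
    and "c = (\<integral>\<omega>. (Y \<omega>)\<^sup>2 \<partial>M)"
  have nonneg: "0 \<le> s\<^sup>2 * a - 2 * s * t * b + t\<^sup>2 * c" for s t
  proof -
    have "0 \<le> (\<integral>\<omega>. (s * X \<omega> - t * Y \<omega>)\<^sup>2 \<partial>M)" by simp
    also have "\<dots> = (\<integral>\<omega>. s\<^sup>2 * (X \<omega>)\<^sup>2 - (2 * s * t) * (X \<omega> * Y \<omega>) + t\<^sup>2 * (Y \<omega>)\<^sup>2 \<partial>M)"
      by (intro Bochner_Integration.integral_cong) (auto simp: power2_eq_square algebra_simps)
    also have "\<dots> = s\<^sup>2 * a - 2 * s * t * b + t\<^sup>2 * c"
      using X Y sq_integrable_mult[OF X Y] by (simp add: a_def b_def c_def sq_integrable_real)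
    finally show ?thesis .
  qed
  have "0 \<le> a" "0 \<le> c" by (auto simp: a_def c_def)
  have "b\<^sup>2 \<le> a * c"
  proof (cases "a = 0")
    case True
    have "b = 0"
    proof (rule ccontr)
      assume "b \<noteq> 0"
      \<comment> \<open>With \<open>a = 0\<close> and \<open>t = 1\<close> the form is
        \<open>c - 2 * s * b\<close>, and this \<open>s\<close> gives it the value -1.\<close>
      then show False
        using nonneg[of "(c + 1) / (2 * b)" 1] True by (simp add: field_simps)
    qed
    then show ?thesis using True by simp
  next
    case False
    then have "0 < a" using \<open>0 \<le> a\<close> by simp
    have "0 \<le> a * (a * c - b\<^sup>2)"
      using nonneg[of b a] by (simp add: power2_eq_square algebra_simps)
    then show ?thesis using \<open>0 < a\<close> by (simp add: zero_le_mult_iff)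
  qed
  then show ?thesis by (simp add: a_def b_def c_def)
qed

text \<open>Stated for sequences rather than series, so that the partial sums over the past and over
  the future can be added before passing to the limit.\<close>

definition ms_tendsto :: "'w measure \<Rightarrow> (nat \<Rightarrow> 'w \<Rightarrow> real) \<Rightarrow> ('w \<Rightarrow> real) \<Rightarrow> bool" where
  "ms_tendsto M F X \<longleftrightarrow> (\<forall>n. sq_integrable M (F n)) \<and> sq_integrable M X \<and>
     (\<lambda>n. \<integral>\<omega>. (F n \<omega> - X \<omega>)\<^sup>2 \<partial>M) \<longlonglongrightarrow> 0"

lemma ms_sums_imp_ms_tendsto:
  "ms_sums M X S \<Longrightarrow> ms_tendsto M (\<lambda>N \<omega>. \<Sum>k<N. X k \<omega>) S"
  unfolding ms_sums_def ms_tendsto_def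
  by (intro conjI allI; (rule sq_integrable_sum)?) auto

text \<open>Continuity of the inner product, which carries covariances from partial sums to their
  limits. The difference of the two products splits into three terms, each containing an error
  factor that Cauchy-Schwarz sends to 0.\<close>

lemma ms_tendsto_inner:
  assumes F: "ms_tendsto M F X" and G: "ms_tendsto M G Y"
  shows "(\<lambda>n. \<integral>\<omega>. F n \<omega> * G n \<omega> \<partial>M) \<longlonglongrightarrow> (\<integral>\<omega>. X \<omega> * Y \<omega> \<partial>M)"
proof -
  have sq: "sq_integrable M (F n)" "sq_integrable M (G n)" "sq_integrable M X" "sq_integrable M Y" for n
    using F G by (auto simp: ms_tendsto_def)
  note dX = sq_integrable_diff[OF sq(1) sq(3)] and dY = sq_integrable_diff[OF sq(2) sq(4)]
  define dF where "dF n = (\<integral>\<omega>. (F n \<omega> - X \<omega>)\<^sup>2 \<partial>M)" for n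
  define dG where "dG n = (\<integral>\<omega>. (G n \<omega> - Y \<omega>)\<^sup>2 \<partial>M)" for n
  have lims: "dF \<longlonglongrightarrow> 0" "dG \<longlonglongrightarrow> 0"
    using F G by (auto simp: ms_tendsto_def dF_def[abs_def] dG_def[abs_def])
  have sqlim: "u \<longlonglongrightarrow> 0" if "\<And>n. (u n)\<^sup>2 \<le> v n" "v \<longlonglongrightarrow> 0" for u v :: "nat \<Rightarrow> real"
  proof -
    have "(\<lambda>n. (u n)\<^sup>2) \<longlonglongrightarrow> 0"
      by (rule tendsto_sandwich[OF _ _ tendsto_const that(2)]) (auto simp: that(1))
    then have "(\<lambda>n. sqrt ((u n)\<^sup>2)) \<longlonglongrightarrow> sqrt 0" by (rule tendsto_real_sqrt)
    then show ?thesis by (simp add: tendsto_rabs_zero_iff)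
  qed
  have CF: "(\<lambda>n. dF n * C) \<longlonglongrightarrow> 0" and CG: "(\<lambda>n. C * dG n) \<longlonglongrightarrow> 0" for C
    using tendsto_mult[OF lims(1) tendsto_const[of C]] tendsto_mult[OF tendsto_const[of C] lims(2)]
    by simp_all
  have FG: "(\<lambda>n. dF n * dG n) \<longlonglongrightarrow> 0"
    using tendsto_mult[OF lims] by simp
  have "(\<lambda>n. \<integral>\<omega>. (F n \<omega> - X \<omega>) * (G n \<omega> - Y \<omega>) \<partial>M) \<longlonglongrightarrow> 0"
    by (rule sqlim[OF _ FG]) (unfold dF_def dG_def, rule Cauchy_Schwarz_integral[OF dX dY])
  moreover have "(\<lambda>n. \<integral>\<omega>. (F n \<omega> - X \<omega>) * Y \<omega> \<partial>M) \<longlonglongrightarrow> 0"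
    by (rule sqlim[OF _ CF]) (unfold dF_def, rule Cauchy_Schwarz_integral[OF dX sq(4)])
  moreover have "(\<lambda>n. \<integral>\<omega>. X \<omega> * (G n \<omega> - Y \<omega>) \<partial>M) \<longlonglongrightarrow> 0"
    by (rule sqlim[OF _ CG]) (unfold dG_def, rule Cauchy_Schwarz_integral[OF sq(3) dY])
  ultimately have "(\<lambda>n. (\<integral>\<omega>. (F n \<omega> - X \<omega>) * (G n \<omega> - Y \<omega>) \<partial>M) + (\<integral>\<omega>. (F n \<omega> - X \<omega>) * Y \<omega> \<partial>M)
      + (\<integral>\<omega>. X \<omega> * (G n \<omega> - Y \<omega>) \<partial>M) + (\<integral>\<omega>. X \<omega> * Y \<omega> \<partial>M))
      \<longlonglongrightarrow> 0 + 0 + 0 + (\<integral>\<omega>. X \<omega> * Y \<omega> \<partial>M)"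
    by (intro tendsto_intros)
  moreover have "(\<integral>\<omega>. (F n \<omega> - X \<omega>) * (G n \<omega> - Y \<omega>) \<partial>M) + (\<integral>\<omega>. (F n \<omega> - X \<omega>) * Y \<omega> \<partial>M)
      + (\<integral>\<omega>. X \<omega> * (G n \<omega> - Y \<omega>) \<partial>M) + (\<integral>\<omega>. X \<omega> * Y \<omega> \<partial>M) = (\<integral>\<omega>. F n \<omega> * G n \<omega> \<partial>M)" for n
  proof -
    have "(\<integral>\<omega>. F n \<omega> * G n \<omega> \<partial>M) = (\<integral>\<omega>. (F n \<omega> - X \<omega>) * (G n \<omega> - Y \<omega>) + (F n \<omega> - X \<omega>) * Y \<omega>
        + X \<omega> * (G n \<omega> - Y \<omega>) + X \<omega> * Y \<omega> \<partial>M)"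
      by (intro Bochner_Integration.integral_cong) (auto simp: algebra_simps)
    then show ?thesis
      by (simp only: Bochner_Integration.integral_add Bochner_Integration.integrable_add
          sq_integrable_mult[OF dX dY] sq_integrable_mult[OF dX sq(4)]
          sq_integrable_mult[OF sq(3) dY] sq_integrable_mult[OF sq(3) sq(4)])
  qed
  ultimately show ?thesis by simp
qed

lemma ms_tendsto_add:
  assumes F: "ms_tendsto M F X" and G: "ms_tendsto M G Y"
  shows "ms_tendsto M (\<lambda>n \<omega>. F n \<omega> + G n \<omega>) (\<lambda>\<omega>. X \<omega> + Y \<omega>)"
proof -
  have sq: "sq_integrable M (F n)" "sq_integrable M (G n)" "sq_integrable M X" "sq_integrable M Y" for n
    using F G by (auto simp: ms_tendsto_def)
  note d = sq_integrable_diff[OF sq(1) sq(3)] sq_integrable_diff[OF sq(2) sq(4)]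
  have "(\<lambda>n. 2 * (\<integral>\<omega>. (F n \<omega> - X \<omega>)\<^sup>2 \<partial>M) + 2 * (\<integral>\<omega>. (G n \<omega> - Y \<omega>)\<^sup>2 \<partial>M)) \<longlonglongrightarrow> 2 * 0 + 2 * 0"
    using F G by (intro tendsto_intros) (auto simp: ms_tendsto_def)
  then have lim: "(\<lambda>n. 2 * (\<integral>\<omega>. (F n \<omega> - X \<omega>)\<^sup>2 \<partial>M) + 2 * (\<integral>\<omega>. (G n \<omega> - Y \<omega>)\<^sup>2 \<partial>M)) \<longlonglongrightarrow> 0" by simp
  have le: "(\<integral>\<omega>. (F n \<omega> + G n \<omega> - (X \<omega> + Y \<omega>))\<^sup>2 \<partial>M)
      \<le> 2 * (\<integral>\<omega>. (F n \<omega> - X \<omega>)\<^sup>2 \<partial>M) + 2 * (\<integral>\<omega>. (G n \<omega> - Y \<omega>)\<^sup>2 \<partial>M)" for n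
  proof -
    have i: "integrable M (\<lambda>\<omega>. (F n \<omega> - X \<omega>)\<^sup>2)" "integrable M (\<lambda>\<omega>. (G n \<omega> - Y \<omega>)\<^sup>2)"
      using d by (auto simp: sq_integrable_real)
    have "integrable M (\<lambda>\<omega>. (F n \<omega> - X \<omega> + (G n \<omega> - Y \<omega>))\<^sup>2)"
      using sq_integrable_add[OF d] by (simp add: sq_integrable_real)
    then have i2: "integrable M (\<lambda>\<omega>. (F n \<omega> + G n \<omega> - (X \<omega> + Y \<omega>))\<^sup>2)"
      by (simp add: algebra_simps)
    have "(\<integral>\<omega>. (F n \<omega> + G n \<omega> - (X \<omega> + Y \<omega>))\<^sup>2 \<partial>M)
        \<le> (\<integral>\<omega>. 2 * (F n \<omega> - X \<omega>)\<^sup>2 + 2 * (G n \<omega> - Y \<omega>)\<^sup>2 \<partial>M)"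
    proof (rule integral_mono[OF i2])
      show "integrable M (\<lambda>\<omega>. 2 * (F n \<omega> - X \<omega>)\<^sup>2 + 2 * (G n \<omega> - Y \<omega>)\<^sup>2)" using i by simp
      have "(a + b)\<^sup>2 \<le> 2 * a\<^sup>2 + 2 * b\<^sup>2" for a b :: real
        using zero_le_power2[of "a - b"] by (simp add: power2_eq_square algebra_simps)
      from this[of "F n x - X x" "G n x - Y x" for x]
      show "(F n x + G n x - (X x + Y x))\<^sup>2 \<le> 2 * (F n x - X x)\<^sup>2 + 2 * (G n x - Y x)\<^sup>2" for x
        by (simp add: algebra_simps)
    qed
    also have "\<dots> = 2 * (\<integral>\<omega>. (F n \<omega> - X \<omega>)\<^sup>2 \<partial>M) + 2 * (\<integral>\<omega>. (G n \<omega> - Y \<omega>)\<^sup>2 \<partial>M)"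
      using i by simp
    finally show ?thesis .
  qed
  have "(\<lambda>n. \<integral>\<omega>. (F n \<omega> + G n \<omega> - (X \<omega> + Y \<omega>))\<^sup>2 \<partial>M) \<longlonglongrightarrow> 0"
    by (rule tendsto_sandwich[OF _ _ tendsto_const lim]) (auto simp: le)
  then show ?thesis
    using sq by (auto simp: ms_tendsto_def intro!: sq_integrable_add)
qed

text \<open>The process is tied to its series only almost surely, so the limit must be exchangeable
  for another version. Measurability of that version is a separate premise, as almost sure equality
  does not supply it.\<close>

lemma ms_tendsto_AE_cong:
  assumes F: "ms_tendsto M F X" and "AE \<omega> in M. Y \<omega> = X \<omega>" and "Y \<in> borel_measurable M"
  shows "ms_tendsto M F Y"
proof -
  have [measurable]: "X \<in> borel_measurable M" "F n \<in> borel_measurable M" for n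
    using F by (auto simp: ms_tendsto_def sq_integrable_real)
  note assms(3)[measurable]
  have "integrable M (\<lambda>\<omega>. (Y \<omega>)\<^sup>2) \<longleftrightarrow> integrable M (\<lambda>\<omega>. (X \<omega>)\<^sup>2)"
    by (rule integrable_cong_AE) (use assms(2) in auto)
  moreover have "(\<integral>\<omega>. (F n \<omega> - Y \<omega>)\<^sup>2 \<partial>M) = (\<integral>\<omega>. (F n \<omega> - X \<omega>)\<^sup>2 \<partial>M)" for n
    by (rule integral_cong_AE) (use assms(2) in auto)
  ultimately show ?thesis
    using F by (auto simp: ms_tendsto_def sq_integrable_real)
qed

section \<open>Mean-square completeness and orthogonal series\<close>

context prob_space
begin

text \<open>Riesz-Fischer. On a probability space Cauchy-Schwarz against the constant 1 turns
  mean-square Cauchy into Cauchy in mean, which gives an almost surely convergent subsequence;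
  Fatou's lemma then compares the whole sequence with its limit.\<close>

lemma ms_complete:
  assumes F: "\<And>n. sq_integrable M (F n)"
    and Cauchy: "\<And>e::real. 0 < e \<Longrightarrow> \<exists>N. \<forall>m\<ge>N. \<forall>n\<ge>N. (\<integral>\<omega>. (F m \<omega> - F n \<omega>)\<^sup>2 \<partial>M) < e"
  shows "\<exists>X. ms_tendsto M F X"
proof -
  have [measurable]: "F n \<in> borel_measurable M" for n
    using F by (auto simp: sq_integrable_real)
  have one: "sq_integrable M (\<lambda>_. 1 :: real)" by (simp add: sq_integrable_real)
  have intF: "integrable M (F n)" for n
    using sq_integrable_mult[OF F one] by simp
  have abs: "sq_integrable M (\<lambda>\<omega>. \<bar>F m \<omega> - F n \<omega>\<bar>)" for m n
    using sq_integrable_diff[OF F F] by (simp add: sq_integrable_real)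
  have L1: "\<exists>N. \<forall>m\<ge>N. \<forall>n\<ge>N. (\<integral>\<omega>. norm (F m \<omega> - F n \<omega>) \<partial>M) < e" if "0 < e" for e
  proof -
    have le: "(\<integral>\<omega>. \<bar>F m \<omega> - F n \<omega>\<bar> \<partial>M)\<^sup>2 \<le> (\<integral>\<omega>. (F m \<omega> - F n \<omega>)\<^sup>2 \<partial>M)" for m n
      using Cauchy_Schwarz_integral[OF abs[of m n] one] by (simp add: prob_space)
    obtain N where N: "\<And>m n. m \<ge> N \<Longrightarrow> n \<ge> N \<Longrightarrow> (\<integral>\<omega>. (F m \<omega> - F n \<omega>)\<^sup>2 \<partial>M) < e\<^sup>2"
      using Cauchy[of "e\<^sup>2"] \<open>0 < e\<close> by auto
    have "(\<integral>\<omega>. norm (F m \<omega> - F n \<omega>) \<partial>M) < e" if "m \<ge> N" "n \<ge> N" for m n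
      by (rule power2_less_imp_less) (use le[of m n] N[OF that] \<open>0 < e\<close> in auto)
    then show ?thesis by blast
  qed
  obtain r where r: "strict_mono r" "AE \<omega> in M. Cauchy (\<lambda>i. F (r i) \<omega>)"
    using cauchy_L1_AE_cauchy_subseq[OF intF L1] by blast
  \<comment> \<open>Where the subsequence diverges, a null set, \<open>lim\<close> has an
    unspecified value; \<open>X\<close> is measurable all the same.\<close>
  define X where "X = (\<lambda>\<omega>. lim (\<lambda>i. F (r i) \<omega>))"
  have Xm [measurable]: "X \<in> borel_measurable M" unfolding X_def by measurable
  have X: "AE \<omega> in M. (\<lambda>i. F (r i) \<omega>) \<longlonglongrightarrow> X \<omega>"
    using r(2) by eventually_elim (simp add: X_def Cauchy_convergent_iff convergent_LIMSEQ_iff)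
  have Fatou: "(\<integral>\<^sup>+\<omega>. ennreal ((F n \<omega> - X \<omega>)\<^sup>2) \<partial>M) \<le> ennreal e"
    if N: "\<And>m. m \<ge> N \<Longrightarrow> (\<integral>\<omega>. (F n \<omega> - F m \<omega>)\<^sup>2 \<partial>M) < e" for n N e
  proof -
    have "(\<integral>\<^sup>+\<omega>. ennreal ((F n \<omega> - X \<omega>)\<^sup>2) \<partial>M)
        = (\<integral>\<^sup>+\<omega>. liminf (\<lambda>i. ennreal ((F n \<omega> - F (r i) \<omega>)\<^sup>2)) \<partial>M)"
    proof (rule nn_integral_cong_AE)
      show "AE \<omega> in M. ennreal ((F n \<omega> - X \<omega>)\<^sup>2) = liminf (\<lambda>i. ennreal ((F n \<omega> - F (r i) \<omega>)\<^sup>2))"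
        using X
      proof eventually_elim
        case (elim \<omega>)
        then have "(\<lambda>i. ennreal ((F n \<omega> - F (r i) \<omega>)\<^sup>2)) \<longlonglongrightarrow> ennreal ((F n \<omega> - X \<omega>)\<^sup>2)"
          by (intro tendsto_ennrealI tendsto_intros)
        from lim_imp_Liminf[OF sequentially_bot this] show ?case by simp
      qed
    qed
    also have "\<dots> \<le> liminf (\<lambda>i. \<integral>\<^sup>+\<omega>. ennreal ((F n \<omega> - F (r i) \<omega>)\<^sup>2) \<partial>M)"
      by (rule nn_integral_liminf) simp
    also have "\<dots> \<le> liminf (\<lambda>i. ennreal e)"
    proof (rule Liminf_mono)
      have "(\<integral>\<^sup>+\<omega>. ennreal ((F n \<omega> - F (r i) \<omega>)\<^sup>2) \<partial>M) \<le> ennreal e" if "i \<ge> N" for i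
      proof -
        have "integrable M (\<lambda>\<omega>. (F n \<omega> - F (r i) \<omega>)\<^sup>2)"
          using sq_integrable_diff[OF F F] by (simp add: sq_integrable_real)
        moreover have "r i \<ge> N" using that seq_suble[OF r(1), of i] by simp
        ultimately show ?thesis
          using N[of "r i"] by (simp add: nn_integral_eq_integral ennreal_leI)
      qed
      then show "eventually (\<lambda>i. (\<integral>\<^sup>+\<omega>. ennreal ((F n \<omega> - F (r i) \<omega>)\<^sup>2) \<partial>M) \<le> ennreal e) sequentially"
        by (intro eventually_sequentiallyI[of N])
    qed
    also have "\<dots> = ennreal e" by (simp add: Liminf_const)
    finally show ?thesis .
  qed
  have sqX: "sq_integrable M X"
  proof -
    obtain N where N: "\<And>m n. m \<ge> N \<Longrightarrow> n \<ge> N \<Longrightarrow> (\<integral>\<omega>. (F m \<omega> - F n \<omega>)\<^sup>2 \<partial>M) < 1"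
      using Cauchy[of 1] by auto
    have "(\<integral>\<^sup>+\<omega>. ennreal ((F N \<omega> - X \<omega>)\<^sup>2) \<partial>M) \<le> ennreal 1"
      by (rule Fatou) (rule N, auto)
    also have "\<dots> < \<infinity>" by simp
    finally have "sq_integrable M (\<lambda>\<omega>. F N \<omega> - X \<omega>)"
      by (simp add: sq_integrable_real integrableI_nonneg)
    from sq_integrable_diff[OF F[of N] this] show ?thesis by simp
  qed
  have "(\<lambda>n. \<integral>\<omega>. (F n \<omega> - X \<omega>)\<^sup>2 \<partial>M) \<longlonglongrightarrow> 0"
  proof (rule LIMSEQ_I)
    fix e :: real assume "0 < e"
    \<comment> \<open>Fatou's lemma weakens the strict bound to \<open>\<le>\<close>; halving
      \<open>e\<close> restores strictness.\<close>
    then obtain N where N: "\<And>m n. m \<ge> N \<Longrightarrow> n \<ge> N \<Longrightarrow> (\<integral>\<omega>. (F m \<omega> - F n \<omega>)\<^sup>2 \<partial>M) < e / 2"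
      using Cauchy[of "e / 2"] by auto
    have "(\<integral>\<omega>. (F n \<omega> - X \<omega>)\<^sup>2 \<partial>M) \<le> e / 2" if "n \<ge> N" for n
    proof -
      have "(\<integral>\<^sup>+\<omega>. ennreal ((F n \<omega> - X \<omega>)\<^sup>2) \<partial>M) \<le> ennreal (e / 2)"
        by (rule Fatou) (rule N[OF that])
      moreover have "integrable M (\<lambda>\<omega>. (F n \<omega> - X \<omega>)\<^sup>2)"
        using sq_integrable_diff[OF F sqX] by (simp add: sq_integrable_real)
      ultimately show ?thesis
        using \<open>0 < e\<close> by (simp add: nn_integral_eq_integral)
    qed
    then show "\<exists>N. \<forall>n\<ge>N. norm ((\<integral>\<omega>. (F n \<omega> - X \<omega>)\<^sup>2 \<partial>M) - 0) < e"
      using \<open>0 < e\<close> by (intro exI[of _ N]) force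
  qed
  then show ?thesis
    using F sqX by (auto simp: ms_tendsto_def)
qed

text \<open>By Pythagoras the squared norm of a block of terms is \<open>v\<close> times the block
  of squared coefficients, so the partial sums inherit the Cauchy property from
  \<open>summ\<close>.\<close>

lemma orthogonal_ms_sums:
  assumes Z: "\<And>k. sq_integrable M (Z k)"
    and orth: "\<And>k l. (\<integral>\<omega>. Z k \<omega> * Z l \<omega> \<partial>M) = (if k = l then v else 0)"
    and summ: "summable (\<lambda>k. (c k)\<^sup>2)"
  shows "\<exists>S. ms_sums M (\<lambda>k \<omega>. c k * Z k \<omega>) S"
proof -
  have sq: "sq_integrable M (\<lambda>\<omega>. c k * Z k \<omega>)" for k
    by (rule sq_integrable_cmult[OF Z])
  have v0: "0 \<le> v"
    using Bochner_Integration.integral_nonneg[of M "\<lambda>\<omega>. Z 0 \<omega> * Z 0 \<omega>"] orth[of 0 0] by simp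
  have block: "(\<integral>\<omega>. (\<Sum>k\<in>I. c k * Z k \<omega>)\<^sup>2 \<partial>M) = (\<Sum>k\<in>I. (c k)\<^sup>2) * v" if "finite I" for I
  proof -
    have "(\<integral>\<omega>. (\<Sum>k\<in>I. c k * Z k \<omega>)\<^sup>2 \<partial>M) = (\<integral>\<omega>. (\<Sum>k\<in>I. \<Sum>l\<in>I. (c k * c l) * (Z k \<omega> * Z l \<omega>)) \<partial>M)"
      by (simp add: power2_eq_square sum_product mult_ac)
    also have "\<dots> = (\<Sum>k\<in>I. \<Sum>l\<in>I. (c k * c l) * (if k = l then v else 0))"
      using sq_integrable_mult[OF Z Z] orth by (simp add: Bochner_Integration.integral_sum)
    also have "\<dots> = (\<Sum>k\<in>I. (c k)\<^sup>2) * v"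
      using that by (simp add: sum_distrib_right power2_eq_square if_distrib[of "(*) _"] cong: if_cong)
    finally show ?thesis .
  qed
  have "\<exists>S. ms_tendsto M (\<lambda>N \<omega>. \<Sum>k<N. c k * Z k \<omega>) S"
  proof (rule ms_complete)
    show "sq_integrable M (\<lambda>\<omega>. \<Sum>k<N. c k * Z k \<omega>)" for N by (intro sq_integrable_sum sq)
    fix e :: real assume "0 < e"
    \<comment> \<open>The variance \<open>v\<close> may be 0, hence the divisor
      \<open>v + 1\<close>.\<close>
    then have "0 < e / (v + 1)" using v0 by simp
    then obtain N where N: "\<And>m n. m \<ge> N \<Longrightarrow> norm (\<Sum>k\<in>{m..<n}. (c k)\<^sup>2) < e / (v + 1)"
      using iffD1[OF summable_Cauchy summ] by blast
    have less: "(\<integral>\<omega>. ((\<Sum>k<n. c k * Z k \<omega>) - (\<Sum>k<m. c k * Z k \<omega>))\<^sup>2 \<partial>M) < e" if "m \<ge> N" "m \<le> n" for m n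
    proof -
      have "(\<Sum>k<n. c k * Z k \<omega>) - (\<Sum>k<m. c k * Z k \<omega>) = (\<Sum>k\<in>{m..<n}. c k * Z k \<omega>)" for \<omega>
        using sum_diff[of "{..<n}" "{..<m}" "\<lambda>k. c k * Z k \<omega>"] that(2)
        by (simp add: ivl_disj_un lessThan_minus_lessThan)
      then have "(\<integral>\<omega>. ((\<Sum>k<n. c k * Z k \<omega>) - (\<Sum>k<m. c k * Z k \<omega>))\<^sup>2 \<partial>M) = (\<Sum>k\<in>{m..<n}. (c k)\<^sup>2) * v"
        using block[of "{m..<n}"] by simp
      also have "\<dots> \<le> (\<Sum>k\<in>{m..<n}. (c k)\<^sup>2) * (v + 1)"
        by (intro mult_left_mono sum_nonneg) auto
      also have "\<dots> < e"
        using N[OF that(1), of n] v0 by (simp add: pos_less_divide_eq sum_nonneg)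
      finally show ?thesis .
    qed
    have "(\<integral>\<omega>. ((\<Sum>k<m. c k * Z k \<omega>) - (\<Sum>k<n. c k * Z k \<omega>))\<^sup>2 \<partial>M) < e" if "m \<ge> N" "n \<ge> N" for m n
      using less[of m n] less[of n m] that by (cases "m \<le> n") (auto simp: power2_commute)
    then show "\<exists>N. \<forall>m\<ge>N. \<forall>n\<ge>N. (\<integral>\<omega>. ((\<Sum>k<m. c k * Z k \<omega>) - (\<Sum>k<n. c k * Z k \<omega>))\<^sup>2 \<partial>M) < e"
      by blast
  qed
  then show ?thesis
    using sq by (auto simp: ms_tendsto_def ms_sums_def)
qed

end

section \<open>Matrix-valued expectations and white noise covariances\<close>

lemma vvT_nth: "vvT v w $ i $ j = v $ i * w $ j"
  by (simp add: vvT_def matrix_matrix_mult_def columnvector_def rowvector_def)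

text \<open>Expanding in the matrix units \<open>E i j\<close> reduces the matrix integral to four
  scalar ones, each integrable by assumption.\<close>

lemma integral_vvT_nth:
  assumes "\<And>i j. integrable M (\<lambda>\<omega>. X \<omega> $ i * Y \<omega> $ j)"
  shows "(\<integral>\<omega>. vvT (X \<omega>) (Y \<omega>) \<partial>M) $ i $ j = (\<integral>\<omega>. X \<omega> $ i * Y \<omega> $ j \<partial>M)"
proof -
  define E where "E = (\<lambda>i j. axis i (axis j 1) :: real^2^2)"
  have ent: "(\<Sum>a\<in>UNIV. \<Sum>b\<in>UNIV. c a b *\<^sub>R E a b) $ i $ j = c i j" for c :: "2 \<Rightarrow> 2 \<Rightarrow> real" and i j
    using exhaust_2[of i] exhaust_2[of j] by (auto simp: E_def sum_2 axis_def)
  have "vvT v w = (\<Sum>a\<in>UNIV. \<Sum>b\<in>UNIV. (v $ a * w $ b) *\<^sub>R E a b)" for v w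
    unfolding vec_eq_iff ent by (simp add: vvT_nth)
  then have "(\<integral>\<omega>. vvT (X \<omega>) (Y \<omega>) \<partial>M)
      = (\<integral>\<omega>. (\<Sum>a\<in>UNIV. \<Sum>b\<in>UNIV. (X \<omega> $ a * Y \<omega> $ b) *\<^sub>R E a b) \<partial>M)" by simp
  also have "\<dots> = (\<Sum>a\<in>UNIV. \<Sum>b\<in>UNIV. (\<integral>\<omega>. X \<omega> $ a * Y \<omega> $ b \<partial>M) *\<^sub>R E a b)"
    using assms by (simp add: sum_2)
  finally show ?thesis by (simp only: ent)
qed

lemma sq_integrable_nth:
  fixes X :: "'w \<Rightarrow> real^'n"
  assumes "sq_integrable M X"
  shows "sq_integrable M (\<lambda>\<omega>. X \<omega> $ i)"
proof -
  have X: "X \<in> borel_measurable M" "integrable M (\<lambda>\<omega>. (norm (X \<omega>))\<^sup>2)"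
    using assms by (auto simp: sq_integrable_def)
  have m: "(\<lambda>\<omega>. X \<omega> $ i) \<in> borel_measurable M"
    using borel_measurable_inner[OF X(1) borel_measurable_const[of "axis i 1"]]
    by (simp add: inner_axis)
  have "integrable M (\<lambda>\<omega>. (X \<omega> $ i)\<^sup>2)"
  proof (rule Bochner_Integration.integrable_bound[OF X(2)])
    show "(\<lambda>\<omega>. (X \<omega> $ i)\<^sup>2) \<in> borel_measurable M" using m by simp
    have "(x $ i)\<^sup>2 \<le> (norm x)\<^sup>2" for x :: "real^'n"
      using component_le_norm_cart[of x i] by (rule abs_le_square_iff[THEN iffD1, of _ "norm x", simplified])
    then show "AE \<omega> in M. norm ((X \<omega> $ i)\<^sup>2) \<le> norm ((norm (X \<omega>))\<^sup>2)" by simp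
  qed
  with m show ?thesis by (simp add: sq_integrable_real)
qed

lemma white_noise_sq_integrable:
  assumes "white_noise M \<epsilon>"
  shows "sq_integrable M (\<lambda>\<omega>. (A *v \<epsilon> n \<omega>) $ i)"
proof -
  have "sq_integrable M (\<lambda>\<omega>. \<epsilon> n \<omega> $ a)" for a
    using assms by (intro sq_integrable_nth) (simp add: white_noise_def)
  then have "sq_integrable M (\<lambda>\<omega>. \<Sum>a\<in>UNIV. A $ i $ a * \<epsilon> n \<omega> $ a)"
    by (intro sq_integrable_sum sq_integrable_cmult)
  then show ?thesis by (simp add: matrix_vector_mult_def)
qed

lemma white_noise_covariance:
  assumes "white_noise M \<epsilon>"
  shows "(\<integral>\<omega>. (A *v \<epsilon> p \<omega>) $ i * (B *v \<epsilon> q \<omega>) $ j \<partial>M)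
    = (if p = q then (A ** transpose B) $ i $ j else 0)"
proof -
  have sq: "sq_integrable M (\<lambda>\<omega>. \<epsilon> n \<omega> $ a)" for n a
    using assms by (intro sq_integrable_nth) (simp add: white_noise_def)
  note int = sq_integrable_mult[OF sq sq]
  have cov: "(\<integral>\<omega>. \<epsilon> p \<omega> $ a * \<epsilon> q \<omega> $ b \<partial>M) = (if p = q \<and> a = b then 1 else 0)" for a b
  proof -
    have "(\<integral>\<omega>. vvT (\<epsilon> p \<omega>) (\<epsilon> q \<omega>) \<partial>M) = (if p = q then mat 1 else 0)"
      using assms by (auto simp: white_noise_def)
    then show ?thesis
      using integral_vvT_nth[OF int, of p q a b]
      by (cases "p = q"; cases "a = b") (simp_all add: mat_def)
  qed
  have "(\<integral>\<omega>. (A *v \<epsilon> p \<omega>) $ i * (B *v \<epsilon> q \<omega>) $ j \<partial>M)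
      = (\<integral>\<omega>. (\<Sum>a\<in>UNIV. \<Sum>b\<in>UNIV. (A $ i $ a * B $ j $ b) * (\<epsilon> p \<omega> $ a * \<epsilon> q \<omega> $ b)) \<partial>M)"
    by (simp add: matrix_vector_mult_def sum_product mult_ac)
  also have "\<dots> = (\<Sum>a\<in>UNIV. \<Sum>b\<in>UNIV. (A $ i $ a * B $ j $ b) * (if p = q \<and> a = b then 1 else 0))"
    unfolding cov[symmetric] using int by (simp add: sum_2)
  also have "\<dots> = (if p = q then (A ** transpose B) $ i $ j else 0)"
    by (simp add: sum_2 matrix_matrix_mult_def transpose_def)
  finally show ?thesis .
qed

text \<open>The index maps \<open>u\<close> and \<open>v\<close> are left free so that all four
  pairings of past and future sums are instances.\<close>

lemma white_noise_partial_sum_covariance: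
  assumes "white_noise M \<epsilon>"
  shows "(\<integral>\<omega>. (\<Sum>k<N. c k * (A *v \<epsilon> (u k) \<omega>) $ i) * (\<Sum>l<N. c l * (B *v \<epsilon> (v l) \<omega>) $ j) \<partial>M)
    = (A ** transpose B) $ i $ j * (\<Sum>k<N. \<Sum>l<N. if u k = v l then c k * c l else 0)"
proof -
  note int = sq_integrable_mult[OF white_noise_sq_integrable[OF assms] white_noise_sq_integrable[OF assms]]
  have "(\<integral>\<omega>. (\<Sum>k<N. c k * (A *v \<epsilon> (u k) \<omega>) $ i) * (\<Sum>l<N. c l * (B *v \<epsilon> (v l) \<omega>) $ j) \<partial>M)
      = (\<integral>\<omega>. (\<Sum>k<N. \<Sum>l<N. (c k * c l) * ((A *v \<epsilon> (u k) \<omega>) $ i * (B *v \<epsilon> (v l) \<omega>) $ j)) \<partial>M)"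
    by (simp only: sum_product) (simp add: mult_ac)
  also have "\<dots> = (\<Sum>k<N. \<Sum>l<N. (c k * c l) * (\<integral>\<omega>. (A *v \<epsilon> (u k) \<omega>) $ i * (B *v \<epsilon> (v l) \<omega>) $ j \<partial>M))"
    by (simp add: Bochner_Integration.integral_sum Bochner_Integration.integrable_sum int)
  also have "\<dots> = (\<Sum>k<N. \<Sum>l<N. (A ** transpose B) $ i $ j * (if u k = v l then c k * c l else 0))"
    by (intro sum.cong refl) (simp add: white_noise_covariance[OF assms])
  finally show ?thesis by (simp only: sum_distrib_left)
qed

text \<open>Existence of a mean-square sum makes the choice in \<open>ms_suminf\<close> meaningful.
  As \<open>s \<noteq> 0\<close>, the times \<open>n - s * int k\<close> are distinct, so the terms
  are orthogonal.\<close>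

lemma (in prob_space) frac_int_white_noise_ms_sums:
  assumes "white_noise M \<epsilon>" "0 < d" "d < 1 / 2" "s \<noteq> 0"
  shows "ms_sums M (\<lambda>k \<omega>. frac_coeff d k * (A *v \<epsilon> (n - s * int k) \<omega>) $ i)
    (frac_int M d s (\<lambda>m \<omega>. (A *v \<epsilon> m \<omega>) $ i) n)"
proof -
  have "\<exists>S. ms_sums M (\<lambda>k \<omega>. frac_coeff d k * (A *v \<epsilon> (n - s * int k) \<omega>) $ i) S"
  proof (rule orthogonal_ms_sums)
    show "sq_integrable M (\<lambda>\<omega>. (A *v \<epsilon> (n - s * int k) \<omega>) $ i)" for k
      by (rule white_noise_sq_integrable[OF assms(1)])
    show "(\<integral>\<omega>. (A *v \<epsilon> (n - s * int k) \<omega>) $ i * (A *v \<epsilon> (n - s * int l) \<omega>) $ i \<partial>M)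
        = (if k = l then (A ** transpose A) $ i $ i else 0)" for k l
      using assms(4) by (simp add: white_noise_covariance[OF assms(1)])
    show "summable (\<lambda>k. (frac_coeff d k)\<^sup>2)" by (rule frac_coeff_sq_summable[OF assms(2,3)])
  qed
  from someI_ex[OF this] show ?thesis
    by (simp add: frac_int_def ms_suminf_def backshift_pow_def)
qed

section \<open>Autocovariance of the two-sided process\<close>

text \<open>The coefficients of \<open>(1 - x) powr (- 2 * d)\<close>, extended by 0 to negative
  lags; this extension encodes the indicators of the closed formula.\<close>

definition frac_convolution :: "real \<Rightarrow> int \<Rightarrow> real" where
  "frac_convolution d h = (if 0 \<le> h then frac_coeff (2 * d) (nat h) else 0)"

lemma (in prob_space) autocov_two_sided:
  assumes wn: "white_noise M \<epsilon>" and d: "0 < d" "d < 1 / 2"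
    and Ym: "\<And>n. Y n \<in> borel_measurable M"
    and Y: "\<And>n. AE \<omega> in M. Y n \<omega> =
           frac_int2 M d 1 (\<lambda>m \<omega>'. Qp *v \<epsilon> m \<omega>') n \<omega> +
           frac_int2 M d (- 1) (\<lambda>m \<omega>'. Qm *v \<epsilon> m \<omega>') n \<omega>"
  shows "autocov M Y n h $ i $ j =
    (Qp ** transpose Qp + Qm ** transpose Qm) $ i $ j * frac_autocorr d (of_int h)
    + (Qp ** transpose Qm) $ i $ j * frac_convolution d h
    + (Qm ** transpose Qp) $ i $ j * frac_convolution d (- h)"
proof -
  define c where "c = frac_coeff d"
  define P where "P = (\<lambda>n i N \<omega>. \<Sum>k<N. c k * (Qp *v \<epsilon> (n - int k) \<omega>) $ i)"
  define R where "R = (\<lambda>n i N \<omega>. \<Sum>k<N. c k * (Qm *v \<epsilon> (n + int k) \<omega>) $ i)"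
  have Ymi: "(\<lambda>\<omega>. Y n \<omega> $ i) \<in> borel_measurable M" for n i
    using borel_measurable_inner[OF Ym borel_measurable_const[of "axis i 1"]]
    by (simp add: inner_axis)
  have PR: "ms_tendsto M (\<lambda>N \<omega>. P n i N \<omega> + R n i N \<omega>) (\<lambda>\<omega>. Y n \<omega> $ i)" for n i
  proof (rule ms_tendsto_AE_cong[OF _ _ Ymi])
    show "ms_tendsto M (\<lambda>N \<omega>. P n i N \<omega> + R n i N \<omega>)
        (\<lambda>\<omega>. frac_int M d 1 (\<lambda>m \<omega>. (Qp *v \<epsilon> m \<omega>) $ i) n \<omega>
           + frac_int M d (- 1) (\<lambda>m \<omega>. (Qm *v \<epsilon> m \<omega>) $ i) n \<omega>)"
      unfolding P_def R_def c_def
      using frac_int_white_noise_ms_sums[OF wn d, of 1 Qp n i]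
        frac_int_white_noise_ms_sums[OF wn d, of "- 1" Qm n i]
      by (intro ms_tendsto_add ms_sums_imp_ms_tendsto) simp_all
    show "AE \<omega> in M. Y n \<omega> $ i = frac_int M d 1 (\<lambda>m \<omega>. (Qp *v \<epsilon> m \<omega>) $ i) n \<omega>
           + frac_int M d (- 1) (\<lambda>m \<omega>. (Qm *v \<epsilon> m \<omega>) $ i) n \<omega>"
      using Y[of n] by eventually_elim (simp add: frac_int2_def)
  qed
  have sqY: "sq_integrable M (\<lambda>\<omega>. Y n \<omega> $ i)" for n i
    using PR[of n i] by (simp add: ms_tendsto_def)
  have sqP: "sq_integrable M (P n i N)" and sqR: "sq_integrable M (R n i N)" for n i N
    unfolding P_def R_def by (intro sq_integrable_sum sq_integrable_cmult white_noise_sq_integrable[OF wn])+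
  \<comment> \<open>Matching noise times fixes the pairings: \<open>n + h - k = n - l\<close> means
    \<open>k - l = h\<close>, \<open>n + h - k = n + l\<close> means \<open>k + l = h\<close>, and
    the two cases starting from \<open>n + h + k\<close> give the same conditions with
    \<open>- h\<close>. The base time \<open>n\<close> drops out.\<close>
  define D where "D = (\<lambda>h N. \<Sum>k<N. \<Sum>l<N. if int k - int l = h then c k * c l else 0)"
  define C where "C = (\<lambda>h N. \<Sum>k<N. \<Sum>l<N. if int k + int l = h then c k * c l else 0)"
  have PP: "(\<integral>\<omega>. P (n + h) i N \<omega> * P n j N \<omega> \<partial>M) = (Qp ** transpose Qp) $ i $ j * D h N" for N
    unfolding P_def white_noise_partial_sum_covariance[OF wn] D_def
    by (intro arg_cong2[where f = "(*)"] sum.cong refl if_cong) auto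
  have PRc: "(\<integral>\<omega>. P (n + h) i N \<omega> * R n j N \<omega> \<partial>M) = (Qp ** transpose Qm) $ i $ j * C h N" for N
    unfolding P_def R_def white_noise_partial_sum_covariance[OF wn] C_def
    by (intro arg_cong2[where f = "(*)"] sum.cong refl if_cong) auto
  have RP: "(\<integral>\<omega>. R (n + h) i N \<omega> * P n j N \<omega> \<partial>M) = (Qm ** transpose Qp) $ i $ j * C (- h) N" for N
    unfolding P_def R_def white_noise_partial_sum_covariance[OF wn] C_def
    by (intro arg_cong2[where f = "(*)"] sum.cong refl if_cong) auto
  have RR: "(\<integral>\<omega>. R (n + h) i N \<omega> * R n j N \<omega> \<partial>M) = (Qm ** transpose Qm) $ i $ j * D (- h) N" for N
    unfolding R_def white_noise_partial_sum_covariance[OF wn] D_def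
    by (intro arg_cong2[where f = "(*)"] sum.cong refl if_cong) auto
  have "(\<integral>\<omega>. (P (n + h) i N \<omega> + R (n + h) i N \<omega>) * (P n j N \<omega> + R n j N \<omega>) \<partial>M)
      = (Qp ** transpose Qp) $ i $ j * D h N + (Qp ** transpose Qm) $ i $ j * C h N
      + (Qm ** transpose Qp) $ i $ j * C (- h) N + (Qm ** transpose Qm) $ i $ j * D (- h) N" for N
  proof -
    have "(\<integral>\<omega>. (P (n + h) i N \<omega> + R (n + h) i N \<omega>) * (P n j N \<omega> + R n j N \<omega>) \<partial>M)
      = (\<integral>\<omega>. P (n + h) i N \<omega> * P n j N \<omega> + P (n + h) i N \<omega> * R n j N \<omega>
          + R (n + h) i N \<omega> * P n j N \<omega> + R (n + h) i N \<omega> * R n j N \<omega> \<partial>M)"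
      by (intro Bochner_Integration.integral_cong refl) (simp add: algebra_simps)
    then show ?thesis
      by (simp only: Bochner_Integration.integral_add Bochner_Integration.integrable_add
          sq_integrable_mult[OF sqP sqP] sq_integrable_mult[OF sqP sqR]
          sq_integrable_mult[OF sqR sqP] sq_integrable_mult[OF sqR sqR] PP PRc RP RR)
  qed
  then have "(\<lambda>N. (Qp ** transpose Qp) $ i $ j * D h N + (Qp ** transpose Qm) $ i $ j * C h N
      + (Qm ** transpose Qp) $ i $ j * C (- h) N + (Qm ** transpose Qm) $ i $ j * D (- h) N)
      \<longlonglongrightarrow> (\<integral>\<omega>. Y (n + h) \<omega> $ i * Y n \<omega> $ j \<partial>M)"
    using ms_tendsto_inner[OF PR PR, of "n + h" i n j] by (simp only:)
  moreover have "(\<lambda>N. (Qp ** transpose Qp) $ i $ j * D h N + (Qp ** transpose Qm) $ i $ j * C h N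
      + (Qm ** transpose Qp) $ i $ j * C (- h) N + (Qm ** transpose Qm) $ i $ j * D (- h) N)
      \<longlonglongrightarrow> (Qp ** transpose Qp) $ i $ j * frac_autocorr d (of_int h)
        + (Qp ** transpose Qm) $ i $ j * frac_convolution d h
        + (Qm ** transpose Qp) $ i $ j * frac_convolution d (- h)
        + (Qm ** transpose Qm) $ i $ j * frac_autocorr d (of_int (- h))"
    unfolding C_def D_def c_def frac_convolution_def
    by (intro tendsto_intros frac_coeff_difference_sums frac_coeff_convolution_sums d)
  ultimately have "(\<integral>\<omega>. Y (n + h) \<omega> $ i * Y n \<omega> $ j \<partial>M)
      = (Qp ** transpose Qp) $ i $ j * frac_autocorr d (of_int h)
        + (Qp ** transpose Qm) $ i $ j * frac_convolution d h
        + (Qm ** transpose Qp) $ i $ j * frac_convolution d (- h)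
        + (Qm ** transpose Qm) $ i $ j * frac_autocorr d (of_int (- h))"
    by (rule LIMSEQ_unique)
  then show ?thesis
    unfolding autocov_def frac_autocorr_uminus[OF d]
    using integral_vvT_nth[OF sq_integrable_mult[OF sqY sqY], of "n + h" n i j]
    by (simp add: algebra_simps)
qed

section \<open>Decay of the two lag functions\<close>

text \<open>The Gamma quotient contributes the power \<open>d - (1 - d)\<close>. Reflection at
  \<open>2 * d\<close> and the double angle formula evaluate the constant factor \<open>K\<close>;
  the cosine is positive because \<open>pi * d < pi / 2\<close>.\<close>

lemma frac_autocorr_asymp:
  assumes d: "0 < d" "d < 1 / 2"
  shows "((\<lambda>h::int. frac_autocorr d (of_int h) / of_int h powr (2 * d - 1))
    \<longlongrightarrow> 1 / (2 * cos (pi * d) * Gamma (2 * d))) at_top"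
proof -
  define K where "K = Gamma (1 - 2 * d) * sin (pi * d) / pi"
  have pos: "sin (pi * d) > 0" "cos (pi * d) > 0" "Gamma (2 * d) > 0"
    using d mult_strict_left_mono[of d "1 / 2" pi]
    by (auto intro!: sin_gt_zero cos_gt_zero Gamma_real_pos)
  have prod: "Gamma (2 * d) * Gamma (1 - 2 * d) = pi / (2 * sin (pi * d) * cos (pi * d))"
    using Gamma_reflection_real[of "2 * d"] sin_double[of "pi * d"] by (simp add: mult_ac)
  have "Gamma (1 - 2 * d) = Gamma (2 * d) * Gamma (1 - 2 * d) / Gamma (2 * d)"
    using pos(3) by simp
  then have "Gamma (1 - 2 * d) = pi / (2 * sin (pi * d) * cos (pi * d)) / Gamma (2 * d)"
    unfolding prod .
  then have K: "K = 1 / (2 * cos (pi * d) * Gamma (2 * d))"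
    unfolding K_def using pos by simp
  have "((\<lambda>h::int. K * (Gamma (of_int h + d) / Gamma (of_int h + (1 - d)) / of_int h powr (d - (1 - d))))
      \<longlongrightarrow> K * 1) at_top"
    by (intro tendsto_mult tendsto_const Gamma_ratio_asymp) (use d in auto)
  moreover have "K * (Gamma (of_int h + d) / Gamma (of_int h + (1 - d)) / of_int h powr (d - (1 - d)))
      = frac_autocorr d (of_int h) / of_int h powr (2 * d - 1)" for h :: int
  proof -
    have "d - (1 - d) = 2 * d - 1" "of_int h + (1 - d) = of_int h + 1 - d" by simp_all
    then show ?thesis by (simp only: K_def frac_autocorr_def) (simp add: mult_ac)
  qed
  ultimately show ?thesis by (simp add: K)
qed

lemma frac_convolution_asymp:
  assumes d: "0 < d"
  shows "((\<lambda>h. frac_convolution d h / of_int h powr (2 * d - 1)) \<longlongrightarrow> 1 / Gamma (2 * d)) at_top"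
proof -
  have "((\<lambda>h::int. 1 / Gamma (2 * d) * (Gamma (of_int h + 2 * d) / Gamma (of_int h + 1) / of_int h powr (2 * d - 1)))
      \<longlongrightarrow> 1 / Gamma (2 * d) * 1) at_top"
    by (intro tendsto_mult tendsto_const Gamma_ratio_asymp) (use d in auto)
  then have "((\<lambda>h::int. 1 / Gamma (2 * d) * (Gamma (of_int h + 2 * d) / Gamma (of_int h + 1) / of_int h powr (2 * d - 1)))
      \<longlongrightarrow> 1 / Gamma (2 * d)) at_top" by simp
  moreover have "eventually (\<lambda>h::int. 1 / Gamma (2 * d) * (Gamma (of_int h + 2 * d) / Gamma (of_int h + 1) / of_int h powr (2 * d - 1))
      = frac_convolution d h / of_int h powr (2 * d - 1)) at_top"
    using eventually_ge_at_top[of "0::int"]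
    by eventually_elim (simp add: frac_convolution_def frac_coeff_def mult_ac)
  ultimately show ?thesis by (rule Lim_transform_eventually)
qed

lemma frac_convolution_uminus_asymp:
  "((\<lambda>h. frac_convolution d (- h) / of_int h powr (2 * d - 1)) \<longlongrightarrow> 0) at_top"
proof (rule tendsto_eventually)
  show "eventually (\<lambda>h. frac_convolution d (- h) / of_int h powr (2 * d - 1) = 0) at_top"
    using eventually_gt_at_top[of "0::int"] by eventually_elim (simp add: frac_convolution_def)
qed

theorem proposition3p5:
  fixes M :: "'w measure" and d q0 q1 :: real
    and \<epsilon> Y :: "int \<Rightarrow> 'w \<Rightarrow> real^2"
    and Qp Qm :: "real^2^2"
  assumes "prob_space M"
    and "0 < d" and "d < 1 / 2"
    and "white_noise M \<epsilon>"
    and "Qp = vector [vector [q0, q1], vector [- q1, q0]]"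
    and "Qp = transpose Qm"
    and "\<And>n. Y n \<in> borel_measurable M"
    and "\<And>n. AE \<omega> in M. Y n \<omega> =
           frac_int2 M d 1 (\<lambda>m \<omega>'. Qp *v \<epsilon> m \<omega>') n \<omega> +
           frac_int2 M d (- 1) (\<lambda>m \<omega>'. Qm *v \<epsilon> m \<omega>') n \<omega>"
  defines "r0 \<equiv> 1 / Gamma (2 * d) *
             (q0\<^sup>2 * (1 / cos (pi * d) + 1) + q1\<^sup>2 * (1 / cos (pi * d) - 1))"
    and "r1 \<equiv> - (2 * q0 * q1 / Gamma (2 * d))"
  shows "(\<forall>n h. autocov M Y n h $ 1 $ 1 = autocov M Y n h $ 2 $ 2 \<and>
               autocov M Y n h $ 1 $ 2 = - autocov M Y n h $ 2 $ 1) \<and>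
    (\<forall>n h. autocov M Y n h $ 1 $ 1 =
           q0\<^sup>2 * (2 * (Gamma (1 - 2 * d) * Gamma (of_int h + d) * sin (pi * d)
                       / (Gamma (of_int h + 1 - d) * pi))
                 + (if h \<ge> 0 then Gamma (2 * d + of_int h) / (Gamma (2 * d) * Gamma (1 + of_int h)) else 0)
                 + (if h \<le> 0 then Gamma (2 * d - of_int h) / (Gamma (2 * d) * Gamma (1 - of_int h)) else 0))
         + q1\<^sup>2 * (2 * (Gamma (1 - 2 * d) * Gamma (of_int h + d) * sin (pi * d)
                       / (Gamma (of_int h + 1 - d) * pi))
                 - (if h \<ge> 0 then Gamma (2 * d + of_int h) / (Gamma (2 * d) * Gamma (1 + of_int h)) else 0)
                 - (if h \<le> 0 then Gamma (2 * d - of_int h) / (Gamma (2 * d) * Gamma (1 - of_int h)) else 0))) \<and>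
    (\<forall>n h. autocov M Y n h $ 1 $ 2 =
           of_int (sgn h) * (2 * q0 * q1 / Gamma (2 * d)) *
             (Gamma (of_int \<bar>h\<bar> + 2 * d) / Gamma (1 + of_int \<bar>h\<bar>))) \<and>
    (\<forall>n j k.
           (\<lambda>h. autocov M Y n h $ j $ k
                 - (vector [vector [r0, - r1], vector [r1, r0]] :: real^2^2) $ j $ k
                     * of_int h powr (2 * d - 1))
             \<in> o[at_top](\<lambda>h::int. of_int h powr (2 * d - 1)))"
proof -
  interpret prob_space M by fact
  note d = assms(2,3)
  define S where "S = (\<lambda>h::int. frac_autocorr d (of_int h))"
  define V where "V = frac_convolution d"
  have Qp: "Qp $ 1 $ 1 = q0" "Qp $ 1 $ 2 = q1" "Qp $ 2 $ 1 = - q1" "Qp $ 2 $ 2 = q0"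
    unfolding assms(5) by simp_all
  have Qm: "Qm $ a $ b = Qp $ b $ a" for a b
    unfolding assms(6) by (simp add: transpose_def)
  note cov = autocov_two_sided[OF assms(4) d assms(7,8)]
  \<comment> \<open>Each equally directed product is \<open>q0^2 + q1^2\<close> times the identity.
    The mixed products are \<open>Qp ** Qp\<close> and its transpose, with
    \<open>q0^2 - q1^2\<close> on the diagonal and \<open>2 * q0 * q1\<close>, up to sign, off
    it.\<close>
  have g11: "autocov M Y n h $ 1 $ 1 = 2 * (q0\<^sup>2 + q1\<^sup>2) * S h + (q0\<^sup>2 - q1\<^sup>2) * (V h + V (- h))"
    and g22: "autocov M Y n h $ 2 $ 2 = 2 * (q0\<^sup>2 + q1\<^sup>2) * S h + (q0\<^sup>2 - q1\<^sup>2) * (V h + V (- h))"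
    and g12: "autocov M Y n h $ 1 $ 2 = 2 * q0 * q1 * (V h - V (- h))"
    and g21: "autocov M Y n h $ 2 $ 1 = - (2 * q0 * q1 * (V h - V (- h)))" for n h
    unfolding cov
    by (simp_all add: S_def V_def matrix_matrix_mult_def transpose_def sum_2 Qm Qp power2_eq_square algebra_simps)
  have Vh: "V h = (if h \<ge> 0 then Gamma (2 * d + of_int h) / (Gamma (2 * d) * Gamma (1 + of_int h)) else 0)" for h
    by (simp add: V_def frac_convolution_def frac_coeff_def add.commute mult.commute)
  have Vmh: "V (- h) = (if h \<le> 0 then Gamma (2 * d - of_int h) / (Gamma (2 * d) * Gamma (1 - of_int h)) else 0)" for h
    unfolding Vh by simp
  \<comment> \<open>For \<open>h \<noteq> 0\<close> exactly one of the two terms survives; at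
    \<open>h = 0\<close> they cancel, in accordance with \<open>sgn 0 = 0\<close>.\<close>
  have V12: "V h - V (- h) = of_int (sgn h) / Gamma (2 * d) * (Gamma (of_int \<bar>h\<bar> + 2 * d) / Gamma (1 + of_int \<bar>h\<bar>))" for h
    unfolding Vh Vmh by (cases h "0::int" rule: linorder_cases) (simp_all add: add.commute)
  define g where "g = (\<lambda>h::int. of_int h powr (2 * d - 1) :: real)"
  have Sg: "((\<lambda>h. S h / g h) \<longlongrightarrow> 1 / (2 * cos (pi * d) * Gamma (2 * d))) at_top"
    unfolding S_def g_def by (rule frac_autocorr_asymp[OF d])
  have Vg: "((\<lambda>h. V h / g h) \<longlongrightarrow> 1 / Gamma (2 * d)) at_top"
    unfolding V_def g_def by (rule frac_convolution_asymp[OF d(1)])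
  have Vmg: "((\<lambda>h. V (- h) / g h) \<longlongrightarrow> 0) at_top"
    unfolding V_def g_def by (rule frac_convolution_uminus_asymp)
  have "((\<lambda>h. 2 * (q0\<^sup>2 + q1\<^sup>2) * (S h / g h) + (q0\<^sup>2 - q1\<^sup>2) * (V h / g h + V (- h) / g h)) \<longlongrightarrow>
      2 * (q0\<^sup>2 + q1\<^sup>2) * (1 / (2 * cos (pi * d) * Gamma (2 * d))) + (q0\<^sup>2 - q1\<^sup>2) * (1 / Gamma (2 * d) + 0)) at_top"
    by (intro tendsto_intros Sg Vg Vmg)
  moreover have "2 * (q0\<^sup>2 + q1\<^sup>2) * (1 / (2 * cos (pi * d) * Gamma (2 * d)))
      + (q0\<^sup>2 - q1\<^sup>2) * (1 / Gamma (2 * d) + 0) = r0"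
  proof -
    \<comment> \<open>With the reciprocals as atoms the identity becomes polynomial.\<close>
    define u w where "u = 1 / cos (pi * d)" and "w = 1 / Gamma (2 * d)"
    have uw: "1 / (2 * cos (pi * d) * Gamma (2 * d)) = 1 / 2 * u * w" by (simp add: u_def w_def)
    show ?thesis
      unfolding r0_def uw unfolding u_def[symmetric] w_def[symmetric] by (simp add: algebra_simps)
  qed
  moreover have "2 * (q0\<^sup>2 + q1\<^sup>2) * (S h / g h) + (q0\<^sup>2 - q1\<^sup>2) * (V h / g h + V (- h) / g h)
      = (2 * (q0\<^sup>2 + q1\<^sup>2) * S h + (q0\<^sup>2 - q1\<^sup>2) * (V h + V (- h))) / g h" for h
    by (simp add: add_divide_distrib distrib_left)
  ultimately have l0: "((\<lambda>h. (2 * (q0\<^sup>2 + q1\<^sup>2) * S h + (q0\<^sup>2 - q1\<^sup>2) * (V h + V (- h))) / g h) \<longlongrightarrow> r0) at_top"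
    by (simp only:)
  have "((\<lambda>h. 2 * q0 * q1 * (V h / g h - V (- h) / g h)) \<longlongrightarrow> 2 * q0 * q1 * (1 / Gamma (2 * d) - 0)) at_top"
    by (intro tendsto_intros Vg Vmg)
  then have l1: "((\<lambda>h. (2 * q0 * q1 * (V h - V (- h))) / g h) \<longlongrightarrow> - r1) at_top"
    by (simp add: r1_def flip: diff_divide_distrib)
  have l1': "((\<lambda>h. - (2 * q0 * q1 * (V h - V (- h))) / g h) \<longlongrightarrow> r1) at_top"
    using tendsto_minus[OF l1] by simp
  have lim: "((\<lambda>h. autocov M Y n h $ j $ k / g h) \<longlongrightarrow>
      (vector [vector [r0, - r1], vector [r1, r0]] :: real^2^2) $ j $ k) at_top" for n j k
    using exhaust_2[of j] exhaust_2[of k] l0 l1 l1' by (auto simp: g11 g12 g21 g22)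
  have g0: "eventually (\<lambda>h. g h \<noteq> 0) at_top"
    using eventually_gt_at_top[of "0::int"] by eventually_elim (simp add: g_def)
  \<comment> \<open>The limit of the quotient by \<open>g\<close> gives the little-o form also when
    the coefficient \<open>r\<close> is 0, as happens for \<open>r1\<close> if \<open>q0\<close> or
    \<open>q1\<close> vanishes.\<close>
  have small: "(\<lambda>h. f h - r * g h) \<in> o[at_top](g)" if f: "((\<lambda>h. f h / g h) \<longlongrightarrow> r) at_top" for f :: "int \<Rightarrow> real" and r
  proof (rule smalloI_tendsto[OF _ g0])
    have "((\<lambda>h. f h / g h - r) \<longlongrightarrow> r - r) at_top" by (intro tendsto_intros f)
    then have "((\<lambda>h. f h / g h - r) \<longlongrightarrow> 0) at_top" by simp
    moreover have "eventually (\<lambda>h. f h / g h - r = (f h - r * g h) / g h) at_top"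
      using g0 by eventually_elim (simp add: field_simps)
    ultimately show "((\<lambda>h. (f h - r * g h) / g h) \<longlongrightarrow> 0) at_top"
      by (rule Lim_transform_eventually)
  qed
  show ?thesis
  proof (intro conjI allI)
    fix n h
    show "autocov M Y n h $ 1 $ 1 = autocov M Y n h $ 2 $ 2"
      and "autocov M Y n h $ 1 $ 2 = - autocov M Y n h $ 2 $ 1"
      by (simp_all add: g11 g12 g21 g22)
  next
    fix n h
    have *: "Gamma (1 - 2 * d) * Gamma (of_int h + d) * sin (pi * d)
        / (Gamma (of_int h + 1 - d) * pi) = S h" by (simp add: S_def frac_autocorr_def)
    show "autocov M Y n h $ 1 $ 1 =
           q0\<^sup>2 * (2 * (Gamma (1 - 2 * d) * Gamma (of_int h + d) * sin (pi * d)
                       / (Gamma (of_int h + 1 - d) * pi))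
                 + (if h \<ge> 0 then Gamma (2 * d + of_int h) / (Gamma (2 * d) * Gamma (1 + of_int h)) else 0)
                 + (if h \<le> 0 then Gamma (2 * d - of_int h) / (Gamma (2 * d) * Gamma (1 - of_int h)) else 0))
         + q1\<^sup>2 * (2 * (Gamma (1 - 2 * d) * Gamma (of_int h + d) * sin (pi * d)
                       / (Gamma (of_int h + 1 - d) * pi))
                 - (if h \<ge> 0 then Gamma (2 * d + of_int h) / (Gamma (2 * d) * Gamma (1 + of_int h)) else 0)
                 - (if h \<le> 0 then Gamma (2 * d - of_int h) / (Gamma (2 * d) * Gamma (1 - of_int h)) else 0))"
      unfolding * Vh[symmetric] Vmh[symmetric] g11 by (simp add: algebra_simps)
    show "autocov M Y n h $ 1 $ 2 =
           of_int (sgn h) * (2 * q0 * q1 / Gamma (2 * d)) *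
             (Gamma (of_int \<bar>h\<bar> + 2 * d) / Gamma (1 + of_int \<bar>h\<bar>))"
      unfolding g12 V12 by simp
  next
    fix n j k
    show "(\<lambda>h. autocov M Y n h $ j $ k
                 - (vector [vector [r0, - r1], vector [r1, r0]] :: real^2^2) $ j $ k
                     * of_int h powr (2 * d - 1))
             \<in> o[at_top](\<lambda>h::int. of_int h powr (2 * d - 1))"
      using small[OF lim[of n j k]] by (simp only: g_def)
  qed
qed

end
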